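(* Let $m,c>0$, let $\Omega\subset\mathbb{R}^n$ be open, let $V:\Omega\to\mathbb{R}$ be of class $C^1$, and let $h\in\mathbb{R}$ be such that $\Omega_h=\{x\in\Omega: V(x)+h>0\}\neq\emptyset$. Let $\Lambda'_h$ and the Maupertuis functional $\mathcal{M}_h$ be as defined in the context. Consider the equation $$\frac{\mathrm d}{\mathrm dt}\left(\frac{m\dot x}{\sqrt{1-|\dot x|^2/c^2}}\right)=\nabla V(x)\qquad (\ast)$$ and the energy law $$\frac{mc^2}{\sqrt{1-|\dot x(t)|^2/c^2}}-V(x(t))=h+mc^2,\qquad \forall\, t\in[0,T].\qquad (\ast\ast)$$ Let $u\in\Lambda'_h$ be a non-constant critical point of $\mathcal{M}_h$. Then there exist $T>0$ and a change of variable $\upsilon:[0,T]\to[0,1]$ such that the function $x:[0,T]\to\mathbb{R}^n$, $x(t)=u(\upsilon(t))$, is a non-constant periodic solution of $(\ast)$ satisfying $(\ast\ast)$. Conversely, let $x:[0,T]\to\Omega_h$ be a non-constant periodic solution of $(\ast)$ satisfying $(\ast\ast)$. Then there exists a change of variable $\varphi:[0,1]\to[0,T]$ such that the function $u:[0,1]\to\mathbb{R}^n$, $u(s)=x(\varphi(s))$, is a non-constant critical point of $\mathcal{M}_h$ in $\Lambda'_h$.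
   Context: Notation: $|\cdot|$ is the Euclidean norm. For $x\in\Omega_h$, $$Z_h(x)=2mV(x)+\frac1{c^2}(V(x)+h)^2 ,$$ and one has $Z_h(x)+2hm>0$ on $\Omega_h$. The set of admissible loops is $$\Lambda'_h=\{u\in H^1([0,1];\mathbb{R}^n):\ u(0)=u(1),\ u(s)\in\Omega_h\ \ \forall\,s\in[0,1]\},$$ an open subset of the Hilbert space $\{u\in H^1([0,1];\mathbb{R}^n): u(0)=u(1)\}$. The Maupertuis functional is $$\mathcal{M}_h(u)=\int_0^1|u'(s)|^2\,ds\ \int_0^1 (Z_h(u(s))+2hm)\,ds,\qquad u\in\Lambda'_h.$$ A critical point of $\mathcal{M}_h$ is a $u\in\Lambda'_h$ with $d\mathcal{M}_h(u)[v]=0$ for all $v\in H^1([0,1];\mathbb{R}^n)$ with $v(0)=v(1)$. A change of variable between two compact intervals is an increasing $C^1$-diffeomorphism of one onto the other. A periodic solution $x$ on $[0,T]$ is a solution of the differential equation (with $|\dot x|<c$) satisfying $x(0)=x(T)$ and $\dot x(0)=\dot x(T)$, i.e. extending to a $T$-periodic solution on $\mathbb{R}$. *)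

theory Defs
  imports "HOL-Analysis.Analysis"
begin

section \<open>The potential\<close>

definition grad :: "(real ^ 'n \<Rightarrow> real) \<Rightarrow> real ^ 'n \<Rightarrow> real ^ 'n"
  where "grad V x = (THE D. GDERIV V x :> D)"

definition C1_potential_on :: "(real ^ 'n) set \<Rightarrow> (real ^ 'n \<Rightarrow> real) \<Rightarrow> bool"
  where "C1_potential_on \<Omega> V \<longleftrightarrow>
    (\<forall>x\<in>\<Omega>. V differentiable (at x)) \<and> continuous_on \<Omega> (grad V)"

definition Hill_region :: "(real ^ 'n) set \<Rightarrow> (real ^ 'n \<Rightarrow> real) \<Rightarrow> real \<Rightarrow> (real ^ 'n) set"
  where "Hill_region \<Omega> V h = {x \<in> \<Omega>. V x + h > 0}"

definition Z :: "real \<Rightarrow> real \<Rightarrow> (real ^ 'n \<Rightarrow> real) \<Rightarrow> real \<Rightarrow> real ^ 'n \<Rightarrow> real"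
  where "Z m c V h x = 2 * m * V x + 1 / c\<^sup>2 * (V x + h)\<^sup>2"


section \<open>The Sobolev space of loops\<close>

text \<open>
  In dimension one, the (continuous representatives of) elements of \<open>H\<^sup>1\<close> on the unit interval
  are the absolutely continuous functions with square integrable derivative, that is, the
  indefinite integrals of square integrable functions. Curves are total functions of which only
  the values on the unit interval are relevant.
\<close>

definition L2_unit :: "(real \<Rightarrow> real ^ 'n) \<Rightarrow> bool"
  where "L2_unit g \<longleftrightarrow>
    g \<in> borel_measurable (lebesgue_on {0..1}) \<and>
    integrable (lebesgue_on {0..1}) (\<lambda>s. (norm (g s))\<^sup>2)"

definition has_weak_deriv :: "(real \<Rightarrow> real ^ 'n) \<Rightarrow> (real \<Rightarrow> real ^ 'n) \<Rightarrow> bool"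
  where "has_weak_deriv u g \<longleftrightarrow>
    L2_unit g \<and> (\<forall>s\<in>{0..1}. (g has_integral (u s - u 0)) {0..s})"

definition H1 :: "(real \<Rightarrow> real ^ 'n) set"
  where "H1 = {u. \<exists>g. has_weak_deriv u g}"

text \<open>A weak derivative is unique up to null sets; one of them is selected.\<close>

definition weak_deriv :: "(real \<Rightarrow> real ^ 'n) \<Rightarrow> real \<Rightarrow> real ^ 'n"
  where "weak_deriv u = (SOME g. has_weak_deriv u g)"

definition H1_norm :: "(real \<Rightarrow> real ^ 'n) \<Rightarrow> real"
  where "H1_norm u =
    sqrt (integral {0..1} (\<lambda>s. (norm (u s))\<^sup>2) + integral {0..1} (\<lambda>s. (norm (weak_deriv u s))\<^sup>2))"

definition H1_loops :: "(real \<Rightarrow> real ^ 'n) set"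
  where "H1_loops = {u \<in> H1. u 0 = u 1}"

definition admissible_loops ::
    "(real ^ 'n) set \<Rightarrow> (real ^ 'n \<Rightarrow> real) \<Rightarrow> real \<Rightarrow> (real \<Rightarrow> real ^ 'n) set"
  where "admissible_loops \<Omega> V h = {u \<in> H1_loops. \<forall>s\<in>{0..1}. u s \<in> Hill_region \<Omega> V h}"


section \<open>The Maupertuis functional and its critical points\<close>

definition maupertuis ::
    "real \<Rightarrow> real \<Rightarrow> (real ^ 'n \<Rightarrow> real) \<Rightarrow> real \<Rightarrow> (real \<Rightarrow> real ^ 'n) \<Rightarrow> real"
  where "maupertuis m c V h u =
    integral {0..1} (\<lambda>s. (norm (weak_deriv u s))\<^sup>2) *
    integral {0..1} (\<lambda>s. Z m c V h (u s) + 2 * h * m)"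

text \<open>
  \<open>D\<close> is the Frechet differential at \<open>u\<close>, with respect to the norm of \<open>H\<^sup>1\<close>, of a functional \<open>F\<close>
  defined on a subset \<open>\<Lambda>\<close> of the space of loops: a bounded linear functional approximating the
  increments of \<open>F\<close> to first order. It is written out because the space of loops is a set of
  functions and not a type of class \<open>real_normed_vector\<close>.
\<close>

definition has_H1_differential ::
    "((real \<Rightarrow> real ^ 'n) \<Rightarrow> real) \<Rightarrow> ((real \<Rightarrow> real ^ 'n) \<Rightarrow> real) \<Rightarrow>
     (real \<Rightarrow> real ^ 'n) \<Rightarrow> (real \<Rightarrow> real ^ 'n) set \<Rightarrow> bool"
  where "has_H1_differential F D u \<Lambda> \<longleftrightarrow>
    (\<forall>v\<in>H1_loops. \<forall>w\<in>H1_loops. D (\<lambda>s. v s + w s) = D v + D w) \<and>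
    (\<forall>v\<in>H1_loops. \<forall>a. D (\<lambda>s. a *\<^sub>R v s) = a * D v) \<and>
    (\<exists>K. \<forall>v\<in>H1_loops. \<bar>D v\<bar> \<le> K * H1_norm v) \<and>
    (\<forall>e>0. \<exists>d>0. \<forall>v\<in>H1_loops. H1_norm v < d \<and> (\<lambda>s. u s + v s) \<in> \<Lambda> \<longrightarrow>
      \<bar>F (\<lambda>s. u s + v s) - F u - D v\<bar> \<le> e * H1_norm v)"

definition maupertuis_critical ::
    "real \<Rightarrow> real \<Rightarrow> (real ^ 'n) set \<Rightarrow> (real ^ 'n \<Rightarrow> real) \<Rightarrow> real \<Rightarrow> (real \<Rightarrow> real ^ 'n) \<Rightarrow> bool"
  where "maupertuis_critical m c \<Omega> V h u \<longleftrightarrow>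
    u \<in> admissible_loops \<Omega> V h \<and>
    (\<exists>D. has_H1_differential (maupertuis m c V h) D u (admissible_loops \<Omega> V h) \<and>
         (\<forall>v\<in>H1_loops. D v = 0))"


section \<open>Changes of variable\<close>

text \<open>Derivatives are taken within the interval, hence one-sided at its endpoints.\<close>

definition C1_on_interval :: "(real \<Rightarrow> real) \<Rightarrow> real \<Rightarrow> real \<Rightarrow> bool"
  where "C1_on_interval f a b \<longleftrightarrow>
    (\<exists>f'. (\<forall>t\<in>{a..b}. (f has_real_derivative f' t) (at t within {a..b})) \<and>
          continuous_on {a..b} f')"

definition change_of_variable :: "(real \<Rightarrow> real) \<Rightarrow> real \<Rightarrow> real \<Rightarrow> real \<Rightarrow> real \<Rightarrow> bool"
  where "change_of_variable f a b a' b' \<longleftrightarrow>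
    bij_betw f {a..b} {a'..b'} \<and> strict_mono_on {a..b} f \<and>
    C1_on_interval f a b \<and> C1_on_interval (the_inv_into {a..b} f) a' b'"


section \<open>Periodic solutions\<close>

definition velocity :: "real \<Rightarrow> (real \<Rightarrow> real ^ 'n) \<Rightarrow> real \<Rightarrow> real ^ 'n"
  where "velocity T x t = vector_derivative x (at t within {0..T})"

definition momentum :: "real \<Rightarrow> real \<Rightarrow> real \<Rightarrow> (real \<Rightarrow> real ^ 'n) \<Rightarrow> real \<Rightarrow> real ^ 'n"
  where "momentum m c T x t =
    (m / sqrt (1 - (norm (velocity T x t))\<^sup>2 / c\<^sup>2)) *\<^sub>R velocity T x t"

definition relativistic_solution ::
    "real \<Rightarrow> real \<Rightarrow> (real ^ 'n) set \<Rightarrow> (real ^ 'n \<Rightarrow> real) \<Rightarrow> real \<Rightarrow> (real \<Rightarrow> real ^ 'n) \<Rightarrow> bool"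
  where "relativistic_solution m c \<Omega> V T x \<longleftrightarrow>
    (\<forall>t\<in>{0..T}.
      x t \<in> \<Omega> \<and>
      x differentiable (at t within {0..T}) \<and>
      norm (velocity T x t) < c \<and>
      (momentum m c T x has_vector_derivative grad V (x t)) (at t within {0..T}))"

definition periodic_solution ::
    "real \<Rightarrow> real \<Rightarrow> (real ^ 'n) set \<Rightarrow> (real ^ 'n \<Rightarrow> real) \<Rightarrow> real \<Rightarrow> (real \<Rightarrow> real ^ 'n) \<Rightarrow> bool"
  where "periodic_solution m c \<Omega> V T x \<longleftrightarrow>
    relativistic_solution m c \<Omega> V T x \<and> x 0 = x T \<and> velocity T x 0 = velocity T x T"

definition energy_law ::
    "real \<Rightarrow> real \<Rightarrow> (real ^ 'n \<Rightarrow> real) \<Rightarrow> real \<Rightarrow> real \<Rightarrow> (real \<Rightarrow> real ^ 'n) \<Rightarrow> bool"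
  where "energy_law m c V h T x \<longleftrightarrow>
    (\<forall>t\<in>{0..T}.
      m * c\<^sup>2 / sqrt (1 - (norm (velocity T x t))\<^sup>2 / c\<^sup>2) - V (x t) = h + m * c\<^sup>2)"

end

theory Submission
  imports Defs
begin

text \<open>
  Put \<open>W = Z + 2hm\<close> and \<open>G = V + h + mc\<^sup>2\<close>, so that \<open>c\<^sup>2 W = G\<^sup>2 - m\<^sup>2 c\<^sup>4\<close> and
  \<open>\<nabla>W = (2G/c\<^sup>2) \<nabla>V\<close>. With \<open>k\<close> the quotient of the two integrals of the Maupertuis functional, a
  non-constant critical loop satisfies \<open>u'' = (k/2) \<nabla>W(u)\<close> (Du Bois-Reymond), and conservation of
  energy, with the constant fixed by integrating over the period, gives \<open>|u'|\<^sup>2 = k W(u)\<close>. In the time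
  with \<open>dt/ds = \<surd>k G(u)/c\<^sup>2\<close> the momentum becomes \<open>u'/\<surd>k\<close>, which turns these two identities into the
  relativistic equation and its energy law. Conversely \<open>ds/dt\<close> proportional to \<open>1/G(x)\<close> turns a solution
  into a loop satisfying both identities, and they make the first variation vanish.
\<close>

section \<open>Square integrable functions\<close>

text \<open>The weight \<open>G\<close> in the change of time comes from the energy law: it says
  that the Lorentz factor is \<open>G / (m * c\<^sup>2)\<close>, so momentum is
  \<open>G / c\<^sup>2\<close> times velocity. If \<open>dt/ds = a * G / c\<^sup>2\<close>, the
  momentum is \<open>u' / a\<close>, and inserting the equation for \<open>u''\<close> gives
  \<open>k / a\<^sup>2\<close> times the gradient of \<open>V\<close>; hence
  \<open>a\<^sup>2 = k\<close>. The obstacle is regularity. A critical loop is only known to lie in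
  \<open>H1\<close>, and its derivative is a class modulo null sets of which
  \<open>weak_deriv\<close> picks one member, so the norm and the functional must first be shown
  independent of that choice. The passage to a classical solution needs integration by parts with
  one merely absolutely continuous factor; it is obtained from an estimate of increments that holds
  at every point, so that no almost everywhere differentiation enters. Criticality speaks of a
  Frechet differential in the \<open>H1\<close> norm. One quantitative expansion of the functional
  serves both directions: it identifies the first variation of a critical loop, and it proves
  differentiability at a loop built from a solution.\<close>

lemma Cauchy_Schwarz_integral:
  fixes f g :: "'b::euclidean_space \<Rightarrow> 'a::real_inner"
  assumes f: "(\<lambda>s. (norm (f s))\<^sup>2) integrable_on S"
    and g: "(\<lambda>s. (norm (g s))\<^sup>2) integrable_on S"
    and fg: "(\<lambda>s. f s \<bullet> g s) integrable_on S"
  shows "\<bar>integral S (\<lambda>s. f s \<bullet> g s)\<bar>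
    \<le> sqrt (integral S (\<lambda>s. (norm (f s))\<^sup>2)) * sqrt (integral S (\<lambda>s. (norm (g s))\<^sup>2))"
proof -
  define a where "a = integral S (\<lambda>s. (norm (f s))\<^sup>2)"
  define b where "b = integral S (\<lambda>s. f s \<bullet> g s)"
  define c where "c = integral S (\<lambda>s. (norm (g s))\<^sup>2)"
  \<comment> \<open>This is the integral of the squared norm of \<open>f - t g\<close>. The
    inequality follows at the minimiser \<open>t = b / c\<close>; for \<open>c = 0\<close> the
    expression is linear in \<open>t\<close>, which forces \<open>b = 0\<close>.\<close>
  have quad: "0 \<le> a - 2 * t * b + t\<^sup>2 * c" for t
  proof -
    have "((\<lambda>s. (norm (f s))\<^sup>2 - (2 * t) * (f s \<bullet> g s) + t\<^sup>2 * (norm (g s))\<^sup>2)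
        has_integral a - 2 * t * b + t\<^sup>2 * c) S"
      unfolding a_def b_def c_def
      by (intro has_integral_add has_integral_diff has_integral_mult_right integrable_integral assms)
    moreover have "(norm (f s))\<^sup>2 - (2 * t) * (f s \<bullet> g s) + t\<^sup>2 * (norm (g s))\<^sup>2
        = (norm (f s - t *\<^sub>R g s))\<^sup>2" for s
      unfolding power2_norm_eq_inner
      by (simp add: inner_diff inner_commute power2_eq_square algebra_simps)
    ultimately show ?thesis
      by (metis (no_types, lifting) has_integral_nonneg zero_le_power2)
  qed
  have "0 \<le> a" "0 \<le> c"
    unfolding a_def c_def by (auto intro!: Henstock_Kurzweil_Integration.integral_nonneg assms)
  have "b\<^sup>2 \<le> a * c"
  proof (cases "c = 0")
    case True
    have "b = 0"
    proof (rule ccontr)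
      assume "b \<noteq> 0"
      \<comment> \<open>At this \<open>t\<close> the linear expression takes the value -1.\<close>
      then show False
        using quad[of "(a + 1) / (2 * b)"] True by simp
    qed
    then show ?thesis using True by simp
  next
    case False
    then have "0 \<le> a - b\<^sup>2 / c"
      using quad[of "b / c"] by (simp add: power2_eq_square)
    then show ?thesis
      using False \<open>0 \<le> c\<close> by (simp add: divide_simps mult.commute split: if_splits)
  qed
  then show ?thesis
    unfolding a_def[symmetric] b_def[symmetric] c_def[symmetric]
    by (metis real_sqrt_abs real_sqrt_le_mono real_sqrt_mult)
qed

lemma L2_unit_square_integrable:
  assumes "L2_unit g"
  shows "(\<lambda>s. (norm (g s))\<^sup>2) integrable_on {0..1}"
  using assms by (auto simp: L2_unit_def intro: integrable_on_lebesgue_on)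

lemma L2_unitI:
  assumes "g \<in> borel_measurable (lebesgue_on {0..1})"
    and "F integrable_on {0..1}" "\<And>s. s \<in> {0..1} \<Longrightarrow> (norm (g s))\<^sup>2 \<le> F s"
  shows "L2_unit g"
proof -
  have "(\<lambda>s. (norm (g s))\<^sup>2) absolutely_integrable_on {0..1}"
    using assms by (intro measurable_bounded_by_integrable_imp_absolutely_integrable[where g = F]) auto
  then show ?thesis
    using assms(1) by (simp add: L2_unit_def set_integrable_def integrable_restrict_space)
qed

lemma L2_unit_inner:
  assumes f: "L2_unit f" and g: "L2_unit g"
  shows "(\<lambda>s. f s \<bullet> g s) absolutely_integrable_on {0..1}"
proof (rule measurable_bounded_by_integrable_imp_absolutely_integrable)
  show "(\<lambda>s. f s \<bullet> g s) \<in> borel_measurable (lebesgue_on {0..1})"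
    using f g by (auto simp: L2_unit_def intro: borel_measurable_inner)
  show "(\<lambda>s. (norm (f s))\<^sup>2 + (norm (g s))\<^sup>2) integrable_on {0..1}"
    by (intro integrable_add L2_unit_square_integrable f g)
  show "norm (f s \<bullet> g s) \<le> (norm (f s))\<^sup>2 + (norm (g s))\<^sup>2" for s
  proof -
    have "norm (f s \<bullet> g s) \<le> norm (f s) * norm (g s)"
      by (simp add: Cauchy_Schwarz_ineq2)
    also have "\<dots> \<le> (norm (f s))\<^sup>2 + (norm (g s))\<^sup>2"
      using sum_squares_bound[of "norm (f s)" "norm (g s)"]
        mult_nonneg_nonneg[of "norm (f s)" "norm (g s)"] by (simp del: mult_nonneg_nonneg)
    finally show ?thesis .
  qed
qed auto

lemma L2_unit_absolutely_integrable:
  assumes "L2_unit g"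
  shows "g absolutely_integrable_on {0..1}"
proof (rule measurable_bounded_by_integrable_imp_absolutely_integrable)
  show "(\<lambda>s. 1 + (norm (g s))\<^sup>2) integrable_on {0..1}"
    by (intro integrable_add L2_unit_square_integrable assms) auto
  show "norm (g s) \<le> 1 + (norm (g s))\<^sup>2" for s
    using sum_squares_bound[of 1 "norm (g s)"] norm_ge_zero[of "g s"]
    by (simp del: norm_ge_zero)
qed (use assms in \<open>auto simp: L2_unit_def\<close>)

lemma L2_unit_scaleR:
  assumes "L2_unit g"
  shows "L2_unit (\<lambda>s. a *\<^sub>R g s)"
  using assms by (auto simp: L2_unit_def power_mult_distrib intro: borel_measurable_scaleR)

lemma L2_unit_add:
  assumes f: "L2_unit f" and g: "L2_unit g"
  shows "L2_unit (\<lambda>s. f s + g s)"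
proof (rule L2_unitI)
  show "(\<lambda>s. 2 * (norm (f s))\<^sup>2 + 2 * (norm (g s))\<^sup>2) integrable_on {0..1}"
    using f g by (intro integrable_add integrable_on_mult_right L2_unit_square_integrable)
  show "(norm (f s + g s))\<^sup>2 \<le> 2 * (norm (f s))\<^sup>2 + 2 * (norm (g s))\<^sup>2" for s
    \<comment> \<open>Parallelogram law: the bound exceeds the left side by the squared norm of
      \<open>f s - g s\<close>.\<close>
    using zero_le_power2[of "norm (f s - g s)"]
    unfolding power2_norm_eq_inner by (simp add: inner_diff inner_add inner_commute)
qed (use f g in \<open>auto simp: L2_unit_def\<close>)

lemma L2_unit_diff:
  assumes "L2_unit f" and "L2_unit g"
  shows "L2_unit (\<lambda>s. f s - g s)"
  using L2_unit_add[OF assms(1) L2_unit_scaleR[OF assms(2), of "-1"]] by simp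

lemma L2_unit_continuous:
  assumes "continuous_on {0..1} g"
  shows "L2_unit g"
proof (rule L2_unitI)
  show "g \<in> borel_measurable (lebesgue_on {0..1})"
    using assms by (intro continuous_imp_measurable_on_sets_lebesgue) auto
  show "(\<lambda>s. (norm (g s))\<^sup>2) integrable_on {0..1}"
    by (intro integrable_continuous_real continuous_intros assms)
qed auto

lemma L2_unit_square_add:
  assumes f: "L2_unit f" and g: "L2_unit g"
  shows "integral {0..1} (\<lambda>s. (norm (f s + g s))\<^sup>2)
    = integral {0..1} (\<lambda>s. (norm (f s))\<^sup>2) + 2 * integral {0..1} (\<lambda>s. f s \<bullet> g s)
      + integral {0..1} (\<lambda>s. (norm (g s))\<^sup>2)"
proof -
  have "((\<lambda>s. (norm (f s))\<^sup>2 + 2 * (f s \<bullet> g s) + (norm (g s))\<^sup>2) has_integral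
      integral {0..1} (\<lambda>s. (norm (f s))\<^sup>2) + 2 * integral {0..1} (\<lambda>s. f s \<bullet> g s)
      + integral {0..1} (\<lambda>s. (norm (g s))\<^sup>2)) {0..1}"
    using f g L2_unit_inner[OF f g]
    by (intro has_integral_add has_integral_mult_right integrable_integral L2_unit_square_integrable)
      (auto simp: set_lebesgue_integral_eq_integral)
  moreover have "(norm (f s + g s))\<^sup>2 = (norm (f s))\<^sup>2 + 2 * (f s \<bullet> g s) + (norm (g s))\<^sup>2" for s
    unfolding power2_norm_eq_inner by (simp add: inner_add inner_commute)
  ultimately show ?thesis by (simp add: integral_unique)
qed

lemma L2_unit_Cauchy_Schwarz:
  assumes f: "L2_unit f" and g: "L2_unit g"
  shows "\<bar>integral {0..1} (\<lambda>s. f s \<bullet> g s)\<bar>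
    \<le> sqrt (integral {0..1} (\<lambda>s. (norm (f s))\<^sup>2)) * sqrt (integral {0..1} (\<lambda>s. (norm (g s))\<^sup>2))"
  using L2_unit_inner[OF f g] f g
  by (intro Cauchy_Schwarz_integral L2_unit_square_integrable)
    (auto simp: set_lebesgue_integral_eq_integral)

text \<open>Cauchy-Schwarz against the constant 1; the interval has length 1, so no factor appears.
  It is the passage from a vanishing square integral to a vanishing integral of the norm, hence to a
  primitive that does not move.\<close>

lemma L2_unit_integral_norm_le:
  assumes g: "L2_unit g"
  shows "integral {0..1} (\<lambda>s. norm (g s)) \<le> sqrt (integral {0..1} (\<lambda>s. (norm (g s))\<^sup>2))"
proof -
  have "(\<lambda>s. norm (g s)) integrable_on {0..1}"
    using L2_unit_absolutely_integrable[OF g] by (simp add: absolutely_integrable_on_def)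
  then show ?thesis
    using Cauchy_Schwarz_integral[of "\<lambda>s. 1::real" "{0..1::real}" "\<lambda>s. norm (g s)"]
      L2_unit_square_integrable[OF g] abs_le_D1 by fastforce
qed

section \<open>Integration by parts for indefinite integrals\<close>

lemma has_integral_increment:
  fixes g w :: "real \<Rightarrow> 'a::euclidean_space"
  assumes w: "\<And>s. s \<in> {0..1} \<Longrightarrow> (g has_integral (w s - w 0)) {0..s}"
    and st: "0 \<le> s" "s \<le> t" "t \<le> 1"
  shows "(g has_integral (w t - w s)) {s..t}"
proof -
  have t: "(g has_integral (w t - w 0)) {0..t}" and s: "(g has_integral (w s - w 0)) {0..s}"
    using w st by auto
  have "g integrable_on {s..t}"
    by (rule integrable_subinterval_real[OF has_integral_integrable[OF t]]) (use st in auto)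
  moreover have "integral {0..s} g + integral {s..t} g = integral {0..t} g"
    using has_integral_integrable[OF t] st by (intro Henstock_Kurzweil_Integration.integral_combine) auto
  ultimately show ?thesis
    using integral_unique[OF s] integral_unique[OF t] by (simp add: has_integral_iff algebra_simps)
qed

lemma has_integral_norm_le:
  fixes f :: "'n::euclidean_space \<Rightarrow> 'a::banach"
  assumes "(f has_integral i) S" and "(g has_integral j) S"
    and "\<And>x. x \<in> S \<Longrightarrow> norm (f x) \<le> g x"
  shows "norm i \<le> j"
proof -
  have "norm (integral S f) \<le> integral S g"
    using assms by (intro Henstock_Kurzweil_Integration.integral_norm_bound_integral)
      (auto intro: has_integral_integrable)
  then show ?thesis
    using assms(1,2) by (simp add: integral_unique)
qed

text \<open>Divided by the distance of the two arguments, the increment of \<open>P\<close> is at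
  most \<open>C\<close> times an increment of \<gamma>, which tends to 0 by continuity. So
  \<open>P\<close> has derivative 0 at every point, with no exceptional null set.\<close>

lemma constant_if_quadratic_bound:
  fixes P :: "real \<Rightarrow> 'a::real_normed_vector" and \<gamma> :: "real \<Rightarrow> real"
  assumes \<gamma>: "continuous_on {a..b} \<gamma>"
    and bound: "\<And>s t. \<lbrakk>a \<le> s; s \<le> t; t \<le> b\<rbrakk> \<Longrightarrow> norm (P t - P s) \<le> C * (t - s) * \<bar>\<gamma> t - \<gamma> s\<bar>"
    and st: "s \<in> {a..b}" "t \<in> {a..b}"
  shows "P s = P t"
proof (rule has_derivative_zero_unique[OF _ _ st])
  fix r assume r: "r \<in> {a..b}"
  have sym: "norm (P t - P r) \<le> C * \<bar>\<gamma> t - \<gamma> r\<bar> * norm (t - r)" if "t \<in> {a..b}" for t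
    using bound[of r t] bound[of t r] that r
    by (cases "r \<le> t") (auto simp: norm_minus_commute abs_minus_commute mult_ac)
  have "((\<lambda>t. C * \<bar>\<gamma> t - \<gamma> r\<bar>) \<longlongrightarrow> C * \<bar>\<gamma> r - \<gamma> r\<bar>) (at r within {a..b})"
    using \<gamma> r by (intro tendsto_intros) (simp add: continuous_on)
  then have lim: "((\<lambda>t. C * \<bar>\<gamma> t - \<gamma> r\<bar>) \<longlongrightarrow> 0) (at r within {a..b})"
    by simp
  show "(P has_derivative (\<lambda>h. 0)) (at r within {a..b})"
    unfolding has_derivative_within
  proof (intro conjI bounded_linear_zero)
    show "((\<lambda>y. (1 / norm (y - r)) *\<^sub>R (P y - (P r + 0))) \<longlongrightarrow> 0) (at r within {a..b})"
    proof (rule Lim_null_comparison[OF _ lim])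
      show "\<forall>\<^sub>F y in at r within {a..b}.
          norm ((1 / norm (y - r)) *\<^sub>R (P y - (P r + 0))) \<le> C * \<bar>\<gamma> y - \<gamma> r\<bar>"
        unfolding eventually_at_filter
        using sym by (intro always_eventually) (auto simp: divide_simps mult_ac)
    qed
  qed
qed simp

text \<open>For a primitive \<open>\<gamma>\<close> of \<open>norm g\<close>, the defect of the product rule over \<open>{s..t}\<close> is at most
  a multiple of \<open>(t - s) * (\<gamma> t - \<gamma> s)\<close>. Hence its derivative vanishes at every point, including
  those at which \<open>w\<close> is not differentiable.\<close>

lemma integration_by_parts_weak:
  fixes F f w g :: "real \<Rightarrow> 'a::euclidean_space"
  assumes F: "\<And>s. s \<in> {0..1} \<Longrightarrow> (F has_vector_derivative f s) (at s within {0..1})"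
    and f: "continuous_on {0..1} f"
    and g: "g absolutely_integrable_on {0..1}"
    and w: "\<And>s. s \<in> {0..1} \<Longrightarrow> (g has_integral (w s - w 0)) {0..s}"
  shows "((\<lambda>s. f s \<bullet> w s + F s \<bullet> g s) has_integral (F 1 \<bullet> w 1 - F 0 \<bullet> w 0)) {0..1}"
proof -
  have contF: "continuous_on {0..1} F"
    by (rule continuous_on_vector_derivative[OF F])
  have gint: "g integrable_on {0..1}" and ngint: "(\<lambda>s. norm (g s)) integrable_on {0..1}"
    using g by (auto simp: absolutely_integrable_on_def)
  have w_eq: "w s = w 0 + integral {0..s} g" if "s \<in> {0..1}" for s
    using w[OF that] by (auto simp: has_integral_iff)
  have contw: "continuous_on {0..1} w"
    by (subst continuous_on_cong[OF refl w_eq])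
      (auto intro!: continuous_intros indefinite_integral_continuous_1 gint)
  define \<gamma> where "\<gamma> = (\<lambda>s. integral {0..s} (\<lambda>s. norm (g s)))"
  have \<gamma>: "continuous_on {0..1} \<gamma>"
    unfolding \<gamma>_def by (intro indefinite_integral_continuous_1 ngint)
  have \<gamma>int: "((\<lambda>s. norm (g s)) has_integral (\<gamma> t - \<gamma> s)) {s..t}"
    if "0 \<le> s" "s \<le> t" "t \<le> 1" for s t
    using _ that
  proof (rule has_integral_increment)
    fix r :: real assume "r \<in> {0..1}"
    then have "(\<lambda>s. norm (g s)) integrable_on {0..r}"
      by (intro integrable_subinterval_real[OF ngint]) auto
    then show "((\<lambda>s. norm (g s)) has_integral (\<gamma> r - \<gamma> 0)) {0..r}"
      by (simp add: \<gamma>_def integrable_integral)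
  qed
  have "bounded (f ` {0..1})"
    by (intro compact_imp_bounded compact_continuous_image f) simp
  then obtain L where L: "\<And>s. s \<in> {0..1} \<Longrightarrow> norm (f s) \<le> L"
    unfolding bounded_iff by blast
  then have "0 \<le> L" using order_trans[OF norm_ge_zero L[of 0]] by auto
  define J where "J = (\<lambda>s. f s \<bullet> w s + F s \<bullet> g s)"
  have "(\<lambda>s. F s \<bullet> g s) absolutely_integrable_on {0..1}"
  proof (rule absolutely_integrable_bounded_measurable_product[where h = inner, OF _ _ _ _ g])
    show "bilinear (inner :: 'a \<Rightarrow> 'a \<Rightarrow> real)"
      by (simp add: bilinear_conv_bounded_bilinear bounded_bilinear_inner)
    show "F \<in> borel_measurable (lebesgue_on {0..1})"
      by (intro continuous_imp_measurable_on_sets_lebesgue contF) simp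
    show "bounded (F ` {0..1})"
      by (intro compact_imp_bounded compact_continuous_image contF) simp
  qed auto
  then have J: "J integrable_on {0..1}"
    unfolding J_def
    by (intro integrable_add integrable_continuous_real[OF continuous_on_inner[OF f contw]]
        set_lebesgue_integral_eq_integral(1))
  \<comment> \<open>The product minus the integral of its formal derivative;
    \<open>P 0 = P 1\<close> is the claim.\<close>
  define P where "P = (\<lambda>s. F s \<bullet> w s - integral {0..s} J)"
  have bound: "norm (P t - P s) \<le> (2 * L) * (t - s) * \<bar>\<gamma> t - \<gamma> s\<bar>"
    if st: "0 \<le> s" "s \<le> t" "t \<le> 1" for s t
  proof -
    have gst: "(g has_integral (w t - w s)) {s..t}"
      by (rule has_integral_increment[OF w st])
    have Fst: "(f has_integral (F t - F r)) {r..t}" if "s \<le> r" "r \<le> t" for r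
      using st that by (intro fundamental_theorem_of_calculus)
        (auto intro: has_vector_derivative_within_subset[OF F])
    have Jst: "(J has_integral (integral {0..t} J - integral {0..s} J)) {s..t}"
      using _ st
    proof (rule has_integral_increment)
      fix r :: real assume "r \<in> {0..1}"
      then have "J integrable_on {0..r}"
        by (intro integrable_subinterval_real[OF J]) auto
      then show "(J has_integral (integral {0..r} J - integral {0..0} J)) {0..r}"
        by (simp add: integrable_integral)
    qed
    \<comment> \<open>The increment of the product is written with \<open>F\<close> frozen at the
      right end and \<open>w\<close> at the left end. Subtracting the running integrand
      \<open>J\<close> then leaves only the differences \<open>F t - F r\<close> and
      \<open>w s - w r\<close>.\<close>
    have "((\<lambda>r. F t \<bullet> g r + f r \<bullet> w s - J r) has_integral
        F t \<bullet> (w t - w s) + (F t - F s) \<bullet> w s - (integral {0..t} J - integral {0..s} J)) {s..t}"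
      using st by (intro has_integral_diff has_integral_add Jst

          has_integral_linear[OF Fst bounded_linear_inner_left, unfolded o_def]
          has_integral_linear[OF gst bounded_linear_inner_right, unfolded o_def]) auto
    moreover have "F t \<bullet> (w t - w s) + (F t - F s) \<bullet> w s - (integral {0..t} J - integral {0..s} J)
        = P t - P s"
      by (simp add: P_def inner_diff algebra_simps)
    moreover have "F t \<bullet> g r + f r \<bullet> w s - J r = (F t - F r) \<bullet> g r + f r \<bullet> (w s - w r)" for r
      by (simp add: J_def inner_diff algebra_simps)
    ultimately have diff: "((\<lambda>r. (F t - F r) \<bullet> g r + f r \<bullet> (w s - w r)) has_integral (P t - P s)) {s..t}"
      by (simp only:)
    have \<gamma>st: "((\<lambda>s. norm (g s)) has_integral (\<gamma> t - \<gamma> s)) {s..t}"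
      using st by (rule \<gamma>int)
    have dom: "((\<lambda>r. L * (t - s) * norm (g r) + L * (\<gamma> t - \<gamma> s)) has_integral
        L * (t - s) * (\<gamma> t - \<gamma> s) + (t - s) *\<^sub>R (L * (\<gamma> t - \<gamma> s))) {s..t}"
      using has_integral_add[OF has_integral_mult_right[OF \<gamma>st, of "L * (t - s)"]
          has_integral_const_real[of "L * (\<gamma> t - \<gamma> s)" s t]] st by simp
    have "norm (integral {s..t} (\<lambda>r. (F t - F r) \<bullet> g r + f r \<bullet> (w s - w r)))
      \<le> integral {s..t} (\<lambda>r. L * (t - s) * norm (g r) + L * (\<gamma> t - \<gamma> s))"
    proof (rule Henstock_Kurzweil_Integration.integral_norm_bound_integral)
      \<comment> \<open>The difference of \<open>F\<close> contributes the factor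
        \<open>t - s\<close>, as \<open>f\<close> is bounded by \<open>L\<close>; the difference of
        \<open>w\<close> contributes \<open>\<gamma> t - \<gamma> s\<close>. In each term,
        integration over \<open>{s..t}\<close> supplies the other factor.\<close>
      fix r assume r: "r \<in> {s..t}"
      have "norm (F t - F r) \<le> L * (t - r)"
      proof -
        have "norm (F t - F r) \<le> (t - r) *\<^sub>R L"
          by (rule has_integral_norm_le[OF Fst[of r] _ L]) (use r st has_integral_const_real[of L r t] in auto)
        then show ?thesis using r by (simp add: mult.commute)
      qed
      also have "\<dots> \<le> L * (t - s)"
        using r \<open>0 \<le> L\<close> by (intro mult_left_mono) auto
      finally have 1: "\<bar>(F t - F r) \<bullet> g r\<bar> \<le> L * (t - s) * norm (g r)"
        by (meson Cauchy_Schwarz_ineq2 mult_right_mono norm_ge_zero order_trans)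
      have "(g has_integral (w r - w s)) {s..r}"
        by (rule has_integral_increment[OF w]) (use st r in auto)
      then have "norm (w r - w s) \<le> \<gamma> r - \<gamma> s"
        by (rule has_integral_norm_le[OF _ \<gamma>int[of s r]]) (use r st in auto)
      also have "\<dots> \<le> \<gamma> t - \<gamma> s"
      proof -
        have "0 \<le> \<gamma> t - \<gamma> r"
          by (rule has_integral_nonneg[OF \<gamma>int[of r t]]) (use r st in auto)
        then show ?thesis by simp
      qed
      finally have "norm (w r - w s) \<le> \<gamma> t - \<gamma> s" .
      have 2: "\<bar>f r \<bullet> (w s - w r)\<bar> \<le> L * (\<gamma> t - \<gamma> s)"
      proof -
        have "\<bar>f r \<bullet> (w s - w r)\<bar> \<le> norm (f r) * norm (w r - w s)"
          using Cauchy_Schwarz_ineq2[of "f r" "w s - w r"] by (simp only: norm_minus_commute)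
        also have "\<dots> \<le> L * (\<gamma> t - \<gamma> s)"
          using L[of r] r st \<open>0 \<le> L\<close> \<open>norm (w r - w s) \<le> \<gamma> t - \<gamma> s\<close> by (intro mult_mono) auto
        finally show ?thesis .
      qed
      show "norm ((F t - F r) \<bullet> g r + f r \<bullet> (w s - w r)) \<le> L * (t - s) * norm (g r) + L * (\<gamma> t - \<gamma> s)"
        using 1 2 by simp
    qed (use has_integral_integrable[OF diff] has_integral_integrable[OF dom] in auto)
    then have "norm (P t - P s) \<le> L * (t - s) * (\<gamma> t - \<gamma> s) + (t - s) * (L * (\<gamma> t - \<gamma> s))"
      using integral_unique[OF diff] integral_unique[OF dom] by simp
    also have "\<dots> = (2 * L) * (t - s) * (\<gamma> t - \<gamma> s)"
      by (simp add: algebra_simps)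
    also have "\<dots> \<le> (2 * L) * (t - s) * \<bar>\<gamma> t - \<gamma> s\<bar>"
      using \<open>0 \<le> L\<close> st by (intro mult_left_mono) auto
    finally show ?thesis .
  qed
  have "P 0 = P 1"
    by (rule constant_if_quadratic_bound[OF \<gamma> bound]) auto
  then show ?thesis
    using J by (simp add: P_def has_integral_iff J_def)
qed

section \<open>Weak derivatives\<close>

text \<open>The hypothesis says that integrals over half-lines vanish. Half-lines are an
  intersection-stable generator of the Borel sets, and vanishing of the integral survives
  complements and countable disjoint unions. A function with zero integral over every measurable set
  is zero almost everywhere.\<close>

lemma AE_zero_if_indefinite_integral_zero:
  fixes g :: "real \<Rightarrow> 'a::euclidean_space"
  assumes g: "g absolutely_integrable_on {0..1}"
    and zero: "\<And>s. s \<in> {0..1} \<Longrightarrow> integral {0..s} g = 0"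
  shows "AE s in lebesgue. s \<in> {0..1} \<longrightarrow> g s = 0"
proof -
  define f where "f = (\<lambda>s. indicator {0..1} s *\<^sub>R g s)"
  have f: "integrable lebesgue f"
    using g by (simp add: f_def set_integrable_def)
  have int_on: "set_integrable lebesgue A f" if "A \<in> sets lebesgue" for A
    using f that unfolding set_integrable_def by (rule integrable_mult_indicator[rotated])
  \<comment> \<open>\<open>f\<close> lives on the unit interval, so the half-line is cut at
    \<open>min 1 a\<close>; for negative \<open>a\<close> nothing remains.\<close>
  have half: "(LINT x:{..a}|lebesgue. f x) = 0" for a
  proof -
    have "(LINT x:{..a}|lebesgue. f x) = (LINT x:{0..min 1 a}|lebesgue. g x)"
      unfolding set_lebesgue_integral_def f_def
      by (intro Bochner_Integration.integral_cong) (auto simp: indicator_def)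
    also have "\<dots> = integral {0..min 1 a} g"
      by (rule set_lebesgue_integral_eq_integral(2), rule set_integrable_subset[OF g]) auto
    also have "\<dots> = 0"
      using zero[of "min 1 a"] by (cases "0 \<le> a") (auto simp: min_def)
    finally show ?thesis .
  qed
  have total: "(LINT x:UNIV|lebesgue. f x) = 0"
  proof -
    have "(LINT x:UNIV|lebesgue. f x) = (LINT x:{..1}|lebesgue. f x)"
      unfolding set_lebesgue_integral_def f_def
      by (intro Bochner_Integration.integral_cong) (auto simp: indicator_def)
    then show ?thesis by (simp add: half)
  qed
  have borel: "(LINT x:A|lebesgue. f x) = 0" if "A \<in> sets borel" for A
  proof -
    have *: "A \<in> sigma_sets UNIV (range (\<lambda>a::real. {..a}))"
      using that by (simp add: borel_eq_atMost)
    have sb: "B \<in> sets lebesgue" if "B \<in> sigma_sets UNIV (range (\<lambda>a::real. {..a}))" for B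
      using that by (metis borel_eq_atMost sets_completionI_sets sets_lborel sets_measure_of top_greatest Pow_UNIV)
    have "Int_stable (range (\<lambda>a::real. {..a}))"
      by (auto simp: Int_stable_def)
    moreover have "range (\<lambda>a::real. {..a}) \<subseteq> Pow UNIV"
      by simp
    ultimately show ?thesis using *
    proof (induction rule: sigma_sets_induct_disjoint)
      case (basic B)
      then show ?case using half by auto
    next
      case empty
      show ?case by (simp add: set_lebesgue_integral_def)
    next
      case (compl B)
      have "(LINT x:(UNIV - B) \<union> B|lebesgue. f x)
          = (LINT x:UNIV - B|lebesgue. f x) + (LINT x:B|lebesgue. f x)"
        using sb[OF compl(1)] by (intro set_integral_Un int_on) auto
      then show ?case using compl total by simp
    next
      case (union B)
      have "(LINT x:(\<Union>i. B i)|lebesgue. f x) = (\<Sum>i. (LINT x:B i|lebesgue. f x))"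
      proof (intro lebesgue_integral_countable_add int_on)
        show B_sets: "B i \<in> sets lebesgue" for i
          using union(2) by (intro sb) auto
        then show "(\<Union>i. B i) \<in> sets lebesgue"
          by auto
      qed (use union(1) in \<open>auto simp: disjoint_family_on_def\<close>)
      then show ?case using union by simp
    qed
  qed
  \<comment> \<open>Sigma-finiteness passes from \<open>lborel\<close> to its completion with the
    same countable cover.\<close>
  obtain K :: "real set set" where K: "countable K" "K \<subseteq> sets lborel" "\<Union>K = space lborel"
    "\<forall>B\<in>K. emeasure lborel B \<noteq> \<infinity>"
    using lborel.sigma_finite_countable by blast
  then have "sigma_finite_measure (lebesgue :: real measure)"
    by (intro sigma_finite_measure.intro exI[of _ K]) (auto simp: emeasure_completion)
  then have "AE x in lebesgue. f x = 0"
  proof (rule sigma_finite_measure.density_zero[OF _ f])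
    fix A :: "real set" assume "A \<in> sets lebesgue"
    \<comment> \<open>A Lebesgue set is a Borel set up to a null set, and the integral ignores the
      latter.\<close>
    then obtain S N N' where A: "A = S \<union> N" "N \<subseteq> N'" "N' \<in> null_sets lborel" "S \<in> sets lborel"
      by (rule sets_completionE)
    then have "AE x in lebesgue. x \<notin> N'"
      by (auto intro!: AE_not_in null_sets_completionI)
    then have "(LINT x:A|lebesgue. f x) = (LINT x:S|lebesgue. f x)"
      unfolding set_lebesgue_integral_def
    proof (intro integral_cong_AE)
      show "(\<lambda>x. indicat_real A x *\<^sub>R f x) \<in> borel_measurable lebesgue"
        "(\<lambda>x. indicat_real S x *\<^sub>R f x) \<in> borel_measurable lebesgue"
        using \<open>A \<in> sets lebesgue\<close> A(4)
        by (auto intro!: borel_measurable_integrable int_on[unfolded set_integrable_def])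
    qed (use A in \<open>auto simp: indicator_def elim!: eventually_mono\<close>)
    then show "(LINT x:A|lebesgue. f x) = 0"
      using borel A by simp
  qed
  then show ?thesis
    by (auto simp: f_def elim!: eventually_mono)
qed

lemma has_weak_deriv_L2: "has_weak_deriv u g \<Longrightarrow> L2_unit g"
  by (simp add: has_weak_deriv_def)

lemma has_weak_deriv_integral:
  "has_weak_deriv u g \<Longrightarrow> s \<in> {0..1} \<Longrightarrow> (g has_integral (u s - u 0)) {0..s}"
  by (simp add: has_weak_deriv_def)

lemma has_weak_deriv_continuous_on:
  assumes "has_weak_deriv u g"
  shows "continuous_on {0..1} u"
proof -
  have eq: "u s = u 0 + integral {0..s} g" if "s \<in> {0..1}" for s
    using integral_unique[OF has_weak_deriv_integral[OF assms that]] by simp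
  have "g integrable_on {0..1}"
    using has_weak_deriv_integral[OF assms, of 1] by auto
  then have "continuous_on {0..1} (\<lambda>s. u 0 + integral {0..s} g)"
    by (intro continuous_intros indefinite_integral_continuous_1)
  then show ?thesis
    by (rule continuous_on_eq) (rule eq[symmetric])
qed

lemma has_weak_deriv_add:
  assumes "has_weak_deriv u g" and "has_weak_deriv v k"
  shows "has_weak_deriv (\<lambda>s. u s + v s) (\<lambda>s. g s + k s)"
  unfolding has_weak_deriv_def
proof (intro conjI ballI)
  fix s :: real assume s: "s \<in> {0..1}"
  have "((\<lambda>s. g s + k s) has_integral (u s - u 0) + (v s - v 0)) {0..s}"
    by (intro has_integral_add has_weak_deriv_integral assms s)
  then show "((\<lambda>s. g s + k s) has_integral u s + v s - (u 0 + v 0)) {0..s}"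
    by (simp add: algebra_simps)
qed (intro L2_unit_add has_weak_deriv_L2[OF assms(1)] has_weak_deriv_L2[OF assms(2)])

lemma has_weak_deriv_scaleR:
  assumes "has_weak_deriv u g"
  shows "has_weak_deriv (\<lambda>s. a *\<^sub>R u s) (\<lambda>s. a *\<^sub>R g s)"
  unfolding has_weak_deriv_def
proof (intro conjI ballI)
  fix s :: real assume s: "s \<in> {0..1}"
  have "((\<lambda>s. a *\<^sub>R g s) has_integral a *\<^sub>R (u s - u 0)) {0..s}"
    by (intro has_integral_cmul has_weak_deriv_integral assms s)
  then show "((\<lambda>s. a *\<^sub>R g s) has_integral a *\<^sub>R u s - a *\<^sub>R u 0) {0..s}"
    by (simp add: scaleR_diff_right)
qed (intro L2_unit_scaleR has_weak_deriv_L2[OF assms])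

lemma has_weak_deriv_if_C1:
  assumes u: "\<And>s. s \<in> {0..1} \<Longrightarrow> (u has_vector_derivative p s) (at s within {0..1})"
    and p: "continuous_on {0..1} p"
  shows "has_weak_deriv u p"
  unfolding has_weak_deriv_def
proof (intro conjI ballI)
  fix s :: real assume s: "s \<in> {0..1}"
  show "(p has_integral u s - u 0) {0..s}"
  proof (rule fundamental_theorem_of_calculus)
    show "(u has_vector_derivative p r) (at r within {0..s})" if "r \<in> {0..s}" for r
      using that s by (intro has_vector_derivative_within_subset[OF u]) auto
  qed (use s in simp)
qed (rule L2_unit_continuous[OF p])

text \<open>The difference of two weak derivatives has zero indefinite integral, hence vanishes
  almost everywhere. This lets \<open>H1_norm\<close> and \<open>maupertuis\<close> be computed with
  whichever derivative is at hand, in particular a classical one, in place of the arbitrary choice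
  \<open>weak_deriv\<close>.\<close>

lemma has_weak_deriv_unique_norm:
  assumes g: "has_weak_deriv u g" and k: "has_weak_deriv u k"
  shows "integral {0..1} (\<lambda>s. (norm (g s))\<^sup>2) = integral {0..1} (\<lambda>s. (norm (k s))\<^sup>2)"
proof -
  have "AE s in lebesgue. s \<in> {0..1} \<longrightarrow> g s - k s = 0"
  proof (rule AE_zero_if_indefinite_integral_zero)
    show "(\<lambda>s. g s - k s) absolutely_integrable_on {0..1}"
      by (intro L2_unit_absolutely_integrable L2_unit_diff has_weak_deriv_L2[OF g] has_weak_deriv_L2[OF k])
    show "integral {0..s} (\<lambda>s. g s - k s) = 0" if "s \<in> {0..1}" for s
      using has_integral_diff[OF has_weak_deriv_integral[OF g that] has_weak_deriv_integral[OF k that]]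
      by (simp add: integral_unique)
  qed
  then obtain N where N: "N \<in> null_sets lebesgue" "\<And>s. s \<notin> N \<Longrightarrow> s \<in> {0..1} \<longrightarrow> g s - k s = 0"
    unfolding completion.AE_iff_null_sets by auto
  show ?thesis
    using N by (intro integral_spike[of N]) (auto simp: negligible_iff_null_sets)
qed

lemma has_weak_deriv_weak_deriv:
  assumes "has_weak_deriv u g"
  shows "has_weak_deriv u (weak_deriv u)"
  unfolding weak_deriv_def using assms by (rule someI[of "has_weak_deriv u"])

lemma H1_norm_eq:
  assumes "has_weak_deriv u g"
  shows "H1_norm u = sqrt (integral {0..1} (\<lambda>s. (norm (u s))\<^sup>2) + integral {0..1} (\<lambda>s. (norm (g s))\<^sup>2))"
  unfolding H1_norm_def has_weak_deriv_unique_norm[OF assms has_weak_deriv_weak_deriv[OF assms]] ..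

lemma maupertuis_eq:
  assumes "has_weak_deriv u g"
  shows "maupertuis m c V h u = integral {0..1} (\<lambda>s. (norm (g s))\<^sup>2) *
    integral {0..1} (\<lambda>s. Z m c V h (u s) + 2 * h * m)"
  unfolding maupertuis_def has_weak_deriv_unique_norm[OF assms has_weak_deriv_weak_deriv[OF assms]] ..

lemma H1_loops_iff: "u \<in> H1_loops \<longleftrightarrow> (\<exists>g. has_weak_deriv u g) \<and> u 0 = u 1"
  by (simp add: H1_loops_def H1_def)

lemma H1_norm_nonneg:
  assumes "has_weak_deriv u g"
  shows "0 \<le> H1_norm u"
  unfolding H1_norm_eq[OF assms]
  using L2_unit_square_integrable[OF L2_unit_continuous[OF has_weak_deriv_continuous_on[OF assms]]]
    L2_unit_square_integrable[OF has_weak_deriv_L2[OF assms]]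
  by (simp add: Henstock_Kurzweil_Integration.integral_nonneg)

lemma H1_norm_scaleR:
  assumes "has_weak_deriv u g"
  shows "H1_norm (\<lambda>s. a *\<^sub>R u s) = \<bar>a\<bar> * H1_norm u"
proof -
  have "H1_norm (\<lambda>s. a *\<^sub>R u s) = sqrt (a\<^sup>2 * (integral {0..1} (\<lambda>s. (norm (u s))\<^sup>2) + integral {0..1} (\<lambda>s. (norm (g s))\<^sup>2)))"
    by (simp add: H1_norm_eq[OF has_weak_deriv_scaleR[OF assms]] power_mult_distrib distrib_left)
  then show ?thesis
    by (simp add: H1_norm_eq[OF assms] real_sqrt_mult)
qed

lemma weak_deriv_norm_le_H1_norm:
  assumes "has_weak_deriv u g"
  shows "sqrt (integral {0..1} (\<lambda>s. (norm (g s))\<^sup>2)) \<le> H1_norm u"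
  unfolding H1_norm_eq[OF assms]
  using L2_unit_square_integrable[OF L2_unit_continuous[OF has_weak_deriv_continuous_on[OF assms]]]
  by (simp add: Henstock_Kurzweil_Integration.integral_nonneg)

text \<open>One-dimensional Sobolev embedding. Any two values of \<open>u\<close> differ by at most
  the integral \<open>G\<close> of \<open>norm (g s)\<close>, so averaging over \<open>r\<close>
  bounds \<open>norm (u s)\<close> by \<open>G\<close> plus the mean of \<open>norm (u r)\<close>.
  Each of the two is at most \<open>H1_norm u\<close>, which gives the factor 2.\<close>

lemma norm_le_H1_norm:
  assumes u: "has_weak_deriv u g" and s: "s \<in> {0..1}"
  shows "norm (u s) \<le> 2 * H1_norm u"
proof -
  note L2g = has_weak_deriv_L2[OF u] and cont = has_weak_deriv_continuous_on[OF u]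
  note L2u = L2_unit_continuous[OF cont]
  have g: "(\<lambda>s. norm (g s)) integrable_on {0..1}"
    using L2_unit_absolutely_integrable[OF L2g] by (simp add: absolutely_integrable_on_def)
  define G where "G = integral {0..1} (\<lambda>s. norm (g s))"
  have incr: "norm (u t - u r) \<le> G" if "0 \<le> r" "r \<le> t" "t \<le> 1" for r t
  proof -
    have sub: "(\<lambda>s. norm (g s)) integrable_on {r..t}"
      using that by (intro integrable_subinterval_real[OF g]) auto
    have "(g has_integral (u t - u r)) {r..t}"
      by (rule has_integral_increment[OF has_weak_deriv_integral[OF u] that])
    then have "norm (u t - u r) \<le> integral {r..t} (\<lambda>s. norm (g s))"
      using integrable_integral[OF sub] by (rule has_integral_norm_le) simp
    also have "\<dots> \<le> G"
      unfolding G_def using that by (intro integral_subset_le sub g) auto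
    finally show ?thesis .
  qed
  have le: "norm (u s) - G \<le> norm (u r)" if "r \<in> {0..1}" for r
    using incr[of r s] incr[of s r] that s norm_triangle_sub[of "u s" "u r"]
    by (cases "r \<le> s") (auto simp: norm_minus_commute)
  have "(\<lambda>s. norm (u s)) integrable_on {0..1}"
    using cont by (intro integrable_continuous_real continuous_intros)
  then have "norm (u s) - G \<le> integral {0..1} (\<lambda>s. norm (u s))"
    using le has_integral_le[OF has_integral_const_real[of "norm (u s) - G" 0 1] integrable_integral]
    by simp
  also have "\<dots> \<le> sqrt (integral {0..1} (\<lambda>s. (norm (u s))\<^sup>2))"
    by (rule L2_unit_integral_norm_le[OF L2u])
  also have "\<dots> \<le> H1_norm u"
    unfolding H1_norm_eq[OF u] using L2_unit_square_integrable[OF L2g]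
    by (simp add: Henstock_Kurzweil_Integration.integral_nonneg)
  finally have "norm (u s) \<le> H1_norm u + G" by simp
  moreover have "G \<le> H1_norm u"
    unfolding G_def using L2_unit_integral_norm_le[OF L2g] weak_deriv_norm_le_H1_norm[OF u] by simp
  ultimately show ?thesis by simp
qed

section \<open>The first variation of the Maupertuis functional\<close>

lemma GDERIV_imp_continuous_on:
  assumes "\<And>x. x \<in> S \<Longrightarrow> GDERIV W x :> g x"
  shows "continuous_on S W"
proof (rule has_derivative_continuous_on)
  show "(W has_derivative (\<lambda>h. h \<bullet> g x)) (at x within S)" if "x \<in> S" for x
    using assms[OF that] unfolding gderiv_def by (rule has_derivative_at_withinI)
qed

text \<open>On a compact tube around \<open>K\<close> inside \<open>S\<close> the gradient is
  uniformly continuous. The tube is used because the segment from \<open>x\<close> to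
  \<open>x + y\<close> may leave \<open>K\<close>; along this segment the gradient stays within
  \<open>e\<close> of \<open>g x\<close>, and the mean value inequality for the linearized function
  yields the bound.\<close>

lemma uniform_first_order_expansion:
  fixes W :: "'a::euclidean_space \<Rightarrow> real"
  assumes S: "open S" and W: "\<And>x. x \<in> S \<Longrightarrow> GDERIV W x :> g x"
    and g: "continuous_on S g" and K: "compact K" "K \<subseteq> S" and e: "e > 0"
  obtains d where "d > 0"
    and "\<And>x y. \<lbrakk>x \<in> K; norm y < d\<rbrakk> \<Longrightarrow> x + y \<in> S"
    and "\<And>x y. \<lbrakk>x \<in> K; norm y < d\<rbrakk> \<Longrightarrow> \<bar>W (x + y) - W x - g x \<bullet> y\<bar> \<le> e * norm y"
proof -
  obtain r where r: "r > 0" "(\<Union>x\<in>K. cball x r) \<subseteq> S"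
    using compact_subset_open_imp_cball_epsilon_subset[OF K(1) S K(2)] .
  define N where "N = {x + y | x y. x \<in> K \<and> y \<in> cball 0 r}"
  have "compact N"
    unfolding N_def by (intro compact_sums K compact_cball)
  moreover have NS: "N \<subseteq> S"
    unfolding N_def using r(2) by (force simp: dist_norm)
  ultimately have "uniformly_continuous_on N g"
    using g by (intro compact_uniformly_continuous continuous_on_subset[OF g])
  then obtain d0 where d0: "d0 > 0"
    "\<And>x z. \<lbrakk>x \<in> N; z \<in> N; dist z x < d0\<rbrakk> \<Longrightarrow> dist (g z) (g x) < e"
    using e unfolding uniformly_continuous_on_def by metis
  define d where "d = min r d0"
  have inN: "z \<in> N" if "x \<in> K" "z \<in> ball x d" for x z
  proof -
    have "z = x + (z - x)" "z - x \<in> cball 0 r"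
      using that(2) by (auto simp: d_def dist_norm norm_minus_commute)
    then show ?thesis
      unfolding N_def using that(1) by blast
  qed
  show thesis
  proof (rule that)
    show "d > 0" using r(1) d0(1) by (simp add: d_def)
    fix x y :: 'a assume x: "x \<in> K" and y: "norm y < d"
    then have ball: "x + t *\<^sub>R (x + y - x) \<in> ball x d" if "t \<in> {0..1}" for t
      using that mult_left_le_one_le[of "norm y" "t"] by (auto simp: dist_norm)
    show "x + y \<in> S"
      using inN[OF x ball[of 1]] NS by auto
    have "norm (W (x + y) - W x - (x + y - x) \<bullet> g x) \<le> norm (x + y - x) * e"
    proof (rule differentiable_bound_linearization[where S = "ball x d" and f' = "\<lambda>z h. h \<bullet> g z"])
      fix z assume z: "z \<in> ball x d"
      have zN: "z \<in> N" "x \<in> N"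
        using inN[OF x z] inN[OF x, of x] \<open>d > 0\<close> by auto
      show "(W has_derivative (\<lambda>h. h \<bullet> g z)) (at z within ball x d)"
        using W[of z] zN NS by (auto simp: gderiv_def intro: has_derivative_at_withinI)
      have "norm (g z - g x) \<le> e"
        using d0(2)[OF zN(2,1)] z by (auto simp: d_def dist_norm norm_minus_commute)
      then have "\<bar>h \<bullet> (g z - g x)\<bar> \<le> e * norm h" for h
        by (metis Cauchy_Schwarz_ineq2 mult.commute mult_left_mono norm_ge_zero order_trans)
      then show "onorm ((\<lambda>h. h \<bullet> g z) - (\<lambda>h. h \<bullet> g x)) \<le> e"
        using e by (intro onorm_bound) (auto simp: inner_diff_right)
    qed (use ball \<open>d > 0\<close> in auto)
    then show "\<bar>W (x + y) - W x - g x \<bullet> y\<bar> \<le> e * norm y"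
      by (simp add: inner_commute mult.commute)
  qed
qed

text \<open>The kinetic integral is exactly quadratic in the increment, while the potential integral
  has a remainder \<open>R\<close> that is small relative to the sup norm of \<open>v\<close>. The
  sup norm is controlled by \<open>H1_norm v\<close>, which also keeps \<open>u + v\<close> in
  \<open>S\<close>. The error is then uniform over all small \<open>v\<close>, as a Frechet
  differential demands.\<close>

lemma maupertuis_expansion:
  fixes W :: "real ^ 'n \<Rightarrow> real"
  assumes S: "open S" and W: "\<And>x. x \<in> S \<Longrightarrow> GDERIV W x :> g x"
    and g: "continuous_on S g"
    and u: "has_weak_deriv u p" "\<And>s. s \<in> {0..1} \<Longrightarrow> u s \<in> S" and e: "e > 0"
  obtains d where "d > 0"
    and "\<And>v q s. \<lbrakk>has_weak_deriv v q; H1_norm v < d; s \<in> {0..1}\<rbrakk> \<Longrightarrow> u s + v s \<in> S"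
    and "\<And>v q. \<lbrakk>has_weak_deriv v q; H1_norm v < d\<rbrakk> \<Longrightarrow>
      \<bar>integral {0..1} (\<lambda>s. (norm (p s + q s))\<^sup>2) * integral {0..1} (\<lambda>s. W (u s + v s))
       - integral {0..1} (\<lambda>s. (norm (p s))\<^sup>2) * integral {0..1} (\<lambda>s. W (u s))
       - (2 * integral {0..1} (\<lambda>s. p s \<bullet> q s) * integral {0..1} (\<lambda>s. W (u s))
          + integral {0..1} (\<lambda>s. (norm (p s))\<^sup>2) * integral {0..1} (\<lambda>s. g (u s) \<bullet> v s))\<bar>
      \<le> e * H1_norm v"
proof -
  note contu = has_weak_deriv_continuous_on[OF u(1)]
  have contW: "continuous_on S W"
    by (rule GDERIV_imp_continuous_on[of S W g]) (rule W)
  define A where "A = integral {0..1} (\<lambda>s. (norm (p s))\<^sup>2)"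
  define B where "B = integral {0..1} (\<lambda>s. W (u s))"
  have "0 \<le> A"
    unfolding A_def using L2_unit_square_integrable[OF has_weak_deriv_L2[OF u(1)]]
    by (intro Henstock_Kurzweil_Integration.integral_nonneg) auto
  have uS: "u ` {0..1} \<subseteq> S"
    using u(2) by auto
  have contgu: "continuous_on {0..1} (\<lambda>s. g (u s))"
    using continuous_on_compose[OF contu continuous_on_subset[OF g uS]] by (simp add: o_def)
  have Ku: "compact (u ` {0..1})"
    using contu by (intro compact_continuous_image) auto
  have "bounded ((\<lambda>s. g (u s)) ` {0..1})"
    by (intro compact_imp_bounded compact_continuous_image contgu) auto
  then obtain G where G: "\<And>s. s \<in> {0..1} \<Longrightarrow> norm (g (u s)) \<le> G"
    unfolding bounded_iff by blast
  have "0 \<le> G"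
    using order_trans[OF norm_ge_zero G[of 0]] by simp
  \<comment> \<open>The second entry makes \<open>A * R\<close>, with \<open>R\<close> at most
    \<open>e1 * (2 * N)\<close>, cost no more than half of \<open>e * N\<close>; the cap 1 bounds
    \<open>R\<close> by \<open>2 * N\<close> inside the quadratic terms.\<close>
  define e1 where "e1 = min 1 (e / (4 * (A + 1)))"
  have e1: "e1 > 0" "e1 \<le> 1" "2 * A * e1 \<le> e / 2"
  proof -
    show "e1 > 0" "e1 \<le> 1"
      using e \<open>0 \<le> A\<close> by (auto simp: e1_def)
    have "2 * A * e1 \<le> 2 * A * (e / (4 * (A + 1)))"
      using \<open>0 \<le> A\<close> by (intro mult_left_mono) (auto simp: e1_def)
    also have "\<dots> \<le> e / 2"
      using \<open>0 \<le> A\<close> e by (simp add: field_simps)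
    finally show "2 * A * e1 \<le> e / 2" .
  qed
  obtain d1 where d1: "d1 > 0"
    "\<And>x y. \<lbrakk>x \<in> u ` {0..1}; norm y < d1\<rbrakk> \<Longrightarrow> x + y \<in> S"
    "\<And>x y. \<lbrakk>x \<in> u ` {0..1}; norm y < d1\<rbrakk> \<Longrightarrow> \<bar>W (x + y) - W x - g x \<bullet> y\<bar> \<le> e1 * norm y"
    by (rule uniform_first_order_expansion[OF S _ g Ku uS e1(1), of W]) (rule W, assumption, rule that)
  \<comment> \<open>\<open>C\<close> dominates the coefficient of \<open>N\<^sup>2\<close> in the
    final estimate; the last summand 1 only secures positivity.\<close>
  define C where "C = \<bar>B\<bar> + (2 * sqrt A + 1) * (2 * G + 2) + 1"
  have "C > 0"
    using \<open>0 \<le> A\<close> \<open>0 \<le> G\<close> by (auto simp: C_def intro!: add_nonneg_pos add_nonneg_nonneg)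
  \<comment> \<open>The three entries give \<open>N\<^sup>2 \<le> N\<close>, a sup norm
    \<open>2 * N\<close> below \<open>d1\<close>, and \<open>N * C \<le> e / 2\<close>.\<close>
  define d where "d = min 1 (min (d1 / 2) (e / (2 * C)))"
  show thesis
  proof (rule that)
    show "d > 0"
      using d1(1) e \<open>C > 0\<close> by (simp add: d_def)
    fix v q :: "real \<Rightarrow> real ^ 'n" assume v: "has_weak_deriv v q" and small: "H1_norm v < d"
    define N where "N = H1_norm v"
    have N: "0 \<le> N" "N \<le> 1" "2 * N < d1" "N * C \<le> e / 2"
      using H1_norm_nonneg[OF v] small \<open>C > 0\<close> by (auto simp: N_def d_def field_simps)
    note contv = has_weak_deriv_continuous_on[OF v]
    have sup: "norm (v s) \<le> 2 * N" if "s \<in> {0..1}" for s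
      unfolding N_def by (rule norm_le_H1_norm[OF v that])
    then have small_v: "norm (v s) < d1" if "s \<in> {0..1}" for s
      using that N(3) by (meson le_less_trans)
    show inS: "u s + v s \<in> S" if "s \<in> {0..1}" for s
      using d1(2) small_v that by blast
    define b where "b = integral {0..1} (\<lambda>s. g (u s) \<bullet> v s)"
    define R where "R = integral {0..1} (\<lambda>s. W (u s + v s)) - B - b"
    define Q where "Q = integral {0..1} (\<lambda>s. (norm (q s))\<^sup>2)"
    define a where "a = integral {0..1} (\<lambda>s. p s \<bullet> q s)"
    have "0 \<le> Q"
      unfolding Q_def using L2_unit_square_integrable[OF has_weak_deriv_L2[OF v]]
      by (intro Henstock_Kurzweil_Integration.integral_nonneg) auto
    have sqrtQ: "sqrt Q \<le> N"
      unfolding Q_def N_def by (rule weak_deriv_norm_le_H1_norm[OF v])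
    then have Q: "Q \<le> N\<^sup>2"
      by (rule sqrt_le_D)
    have a: "\<bar>a\<bar> \<le> sqrt A * N"
    proof -
      have "\<bar>a\<bar> \<le> sqrt A * sqrt Q"
        unfolding a_def A_def Q_def
        by (rule L2_unit_Cauchy_Schwarz[OF has_weak_deriv_L2[OF u(1)] has_weak_deriv_L2[OF v]])
      also have "\<dots> \<le> sqrt A * N"
        using sqrtQ \<open>0 \<le> A\<close> by (intro mult_left_mono) auto
      finally show ?thesis .
    qed
    have int_b: "((\<lambda>s. g (u s) \<bullet> v s) has_integral b) {0..1}"
      unfolding b_def
      by (intro integrable_integral integrable_continuous_real continuous_on_inner contgu contv)
    have b: "\<bar>b\<bar> \<le> 2 * G * N"
    proof -
      have "norm b \<le> 2 * G * N"
      proof (rule has_integral_norm_le[OF int_b])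
        show "((\<lambda>s. 2 * G * N) has_integral 2 * G * N) {0..1::real}"
          using has_integral_const_real[of "2 * G * N" 0 1] by simp
        show "norm (g (u s) \<bullet> v s) \<le> 2 * G * N" if "s \<in> {0..1}" for s
        proof -
          have "norm (g (u s) \<bullet> v s) \<le> norm (g (u s)) * norm (v s)"
            by (simp add: Cauchy_Schwarz_ineq2)
          also have "\<dots> \<le> G * (2 * N)"
            by (intro mult_mono G sup that \<open>0 \<le> G\<close> norm_ge_zero)
          finally show ?thesis by simp
        qed
      qed
      then show ?thesis by simp
    qed
    have R: "\<bar>R\<bar> \<le> e1 * (2 * N)"
    proof -
      have "continuous_on {0..1} (\<lambda>s. W (u s + v s))"
        using inS by (intro continuous_on_compose2[OF contW] continuous_on_add contu contv) auto
      moreover have "continuous_on {0..1} (\<lambda>s. W (u s))"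
        using uS by (intro continuous_on_compose2[OF contW contu]) auto
      ultimately have "((\<lambda>s. W (u s + v s) - W (u s) - g (u s) \<bullet> v s) has_integral R) {0..1}"
        unfolding R_def B_def
        by (intro has_integral_diff int_b integrable_integral integrable_continuous_real)
      moreover have "((\<lambda>s. e1 * (2 * N)) has_integral e1 * (2 * N)) {0..1::real}"
        using has_integral_const_real[of "e1 * (2 * N)" 0 1] by simp
      moreover have "norm (W (u s + v s) - W (u s) - g (u s) \<bullet> v s) \<le> e1 * (2 * N)"
        if "s \<in> {0..1}" for s
      proof -
        have "norm (W (u s + v s) - W (u s) - g (u s) \<bullet> v s) \<le> e1 * norm (v s)"
          using d1(3)[of "u s" "v s"] small_v[OF that] that by simp
        also have "\<dots> \<le> e1 * (2 * N)"
          using sup[OF that] e1(1) by (intro mult_left_mono) auto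
        finally show ?thesis .
      qed
      ultimately have "norm R \<le> e1 * (2 * N)"
        by (rule has_integral_norm_le)
      then show ?thesis by simp
    qed
    have sq: "integral {0..1} (\<lambda>s. (norm (p s + q s))\<^sup>2) = A + 2 * a + Q"
      unfolding A_def a_def Q_def
      by (rule L2_unit_square_add[OF has_weak_deriv_L2[OF u(1)] has_weak_deriv_L2[OF v]])
    \<comment> \<open>After removal of the first-order part, every term contains \<open>Q\<close>,
      \<open>R\<close> or a product of two increments. Only \<open>A * R\<close> is not quadratic in
      \<open>N\<close>, and \<open>e1\<close> was chosen for it.\<close>
    have "\<bar>(A + 2 * a + Q) * (B + b + R) - A * B - (2 * a * B + A * b)\<bar>
        = \<bar>Q * B + A * R + (2 * a + Q) * (b + R)\<bar>"
      by (simp add: algebra_simps)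
    also have "\<dots> \<le> Q * \<bar>B\<bar> + A * \<bar>R\<bar> + \<bar>2 * a + Q\<bar> * \<bar>b + R\<bar>"
      using \<open>0 \<le> A\<close> \<open>0 \<le> Q\<close> abs_triangle_ineq[of "Q * B + A * R" "(2 * a + Q) * (b + R)"]
        abs_triangle_ineq[of "Q * B" "A * R"] by (simp add: abs_mult)
    also have "\<dots> \<le> N\<^sup>2 * \<bar>B\<bar> + A * (e1 * (2 * N)) + ((2 * sqrt A + 1) * N) * ((2 * G + 2) * N)"
    proof (intro add_mono mult_mono)
      have "N\<^sup>2 \<le> N"
        using N by (simp add: power2_eq_square mult_left_le)
      then show "\<bar>2 * a + Q\<bar> \<le> (2 * sqrt A + 1) * N"
        using a Q \<open>0 \<le> Q\<close> by (simp add: algebra_simps)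
      have "\<bar>R\<bar> \<le> 2 * N"
        using R mult_right_mono[OF e1(2), of "2 * N"] N(1) by simp
      then show "\<bar>b + R\<bar> \<le> (2 * G + 2) * N"
        using b by (simp add: algebra_simps)
    qed (use \<open>0 \<le> A\<close> \<open>0 \<le> G\<close> N Q R in auto)
    also have "\<dots> \<le> N * (2 * A * e1) + N * (N * C)"
      using N(1) by (simp add: C_def power2_eq_square algebra_simps)
    also have "\<dots> \<le> N * (e / 2) + N * (e / 2)"
      using e1(3) N by (intro add_mono mult_left_mono)
    also have "\<dots> = e * N"
      by simp
    finally show "\<bar>integral {0..1} (\<lambda>s. (norm (p s + q s))\<^sup>2) * integral {0..1} (\<lambda>s. W (u s + v s))
       - integral {0..1} (\<lambda>s. (norm (p s))\<^sup>2) * integral {0..1} (\<lambda>s. W (u s))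
       - (2 * integral {0..1} (\<lambda>s. p s \<bullet> q s) * integral {0..1} (\<lambda>s. W (u s))
          + integral {0..1} (\<lambda>s. (norm (p s))\<^sup>2) * integral {0..1} (\<lambda>s. g (u s) \<bullet> v s))\<bar>
      \<le> e * H1_norm v"
      unfolding sq by (simp add: A_def[symmetric] B_def[symmetric] b_def[symmetric] a_def[symmetric]
          N_def[symmetric] R_def)
  qed
qed

text \<open>\<open>grad\<close> is a definite description, so existence and uniqueness are both due.
  Existence is the Riesz representation of the derivative, whose vector is the adjoint applied to
  1.\<close>

lemma GDERIV_grad:
  fixes V :: "real ^ 'n \<Rightarrow> real"
  assumes "V differentiable (at x)"
  shows "GDERIV V x :> grad V x"
proof -
  obtain f' where f': "(V has_derivative f') (at x)"
    using assms by (auto simp: differentiable_def)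
  then have "linear f'"
    using has_derivative_linear by blast
  then have "f' = (\<lambda>h. h \<bullet> adjoint f' 1)"
    using adjoint_works[of f' _ 1] by (auto simp: fun_eq_iff)
  then have D: "GDERIV V x :> adjoint f' 1"
    using f' by (simp add: gderiv_def)
  have "E = adjoint f' 1" if "GDERIV V x :> E" for E
  proof -
    have "(\<lambda>h. h \<bullet> E) = (\<lambda>h. h \<bullet> adjoint f' 1)"
      using D that unfolding gderiv_def by (rule has_derivative_unique[rotated])
    then show ?thesis
      by (metis vector_eq_ldot)
  qed
  then show ?thesis
    unfolding grad_def using D by (rule theI[where P = "\<lambda>D. GDERIV V x :> D", rotated])
qed

definition Z_grad :: "real \<Rightarrow> real \<Rightarrow> (real ^ 'n \<Rightarrow> real) \<Rightarrow> real \<Rightarrow> real ^ 'n \<Rightarrow> real ^ 'n"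
  where "Z_grad m c V h x = (2 / c\<^sup>2 * (V x + h + m * c\<^sup>2)) *\<^sub>R grad V x"

lemma GDERIV_Z:
  assumes "C1_potential_on \<Omega> V" and "x \<in> \<Omega>" and "c \<noteq> 0"
  shows "GDERIV (\<lambda>x. Z m c V h x + 2 * h * m) x :> Z_grad m c V h x"
proof -
  have V: "(V has_derivative (\<lambda>y. y \<bullet> grad V x)) (at x)"
    using GDERIV_grad[of V x] assms by (simp add: gderiv_def C1_potential_on_def)
  show ?thesis
    unfolding gderiv_def Z_def Z_grad_def
    by (rule derivative_eq_intros V refl | (rule ext, use assms(3) in \<open>simp add: field_simps\<close>))+
qed

lemma continuous_on_potential:
  assumes "C1_potential_on \<Omega> V"
  shows "continuous_on \<Omega> V"
  using assms unfolding C1_potential_on_def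
  by (intro GDERIV_imp_continuous_on[of \<Omega> V "grad V"] GDERIV_grad) auto

lemma continuous_on_Z_grad:
  assumes "C1_potential_on \<Omega> V"
  shows "continuous_on \<Omega> (Z_grad m c V h)"
  unfolding Z_grad_def
  using assms by (intro continuous_intros continuous_on_potential) (auto simp: C1_potential_on_def)

lemma open_Hill_region:
  assumes "open \<Omega>" and "C1_potential_on \<Omega> V"
  shows "open (Hill_region \<Omega> V h)"
proof -
  have "Hill_region \<Omega> V h = \<Omega> \<inter> (\<lambda>x. V x + h) -` {0<..}"
    by (auto simp: Hill_region_def)
  then show ?thesis
    using continuous_open_preimage[of \<Omega> "\<lambda>x. V x + h" "{0<..}"] assms
    by (simp add: continuous_on_add continuous_on_potential)
qed

lemma Z_energy:
  assumes "c \<noteq> 0"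
  shows "c\<^sup>2 * (Z m c V h x + 2 * h * m) = (V x + h + m * c\<^sup>2)\<^sup>2 - (m * c\<^sup>2)\<^sup>2"
  using assms by (simp add: Z_def power2_eq_square field_simps)

text \<open>The increment of the functional along \<open>a *\<^sub>R v\<close> is approximated both
  by the vanishing differential \<open>D\<close> and by the explicit expansion, each with error
  \<open>e * (a * N)\<close>. Everything scales linearly in \<open>a\<close>, so division by
  \<open>a\<close> leaves the bound \<open>2 * e * N\<close> with \<open>e\<close>
  arbitrary.\<close>

lemma critical_first_variation:
  assumes c: "c \<noteq> 0" and \<Omega>: "open \<Omega>" "C1_potential_on \<Omega> V"
    and crit: "maupertuis_critical m c \<Omega> V h u"
    and u: "has_weak_deriv u p" and v: "has_weak_deriv v q" "v 0 = v 1"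
  shows "2 * integral {0..1} (\<lambda>s. p s \<bullet> q s) * integral {0..1} (\<lambda>s. Z m c V h (u s) + 2 * h * m)
    + integral {0..1} (\<lambda>s. (norm (p s))\<^sup>2) * integral {0..1} (\<lambda>s. Z_grad m c V h (u s) \<bullet> v s) = 0"
    (is "?\<delta> = 0")
proof -
  let ?S = "Hill_region \<Omega> V h"
  have S: "?S \<subseteq> \<Omega>" by (auto simp: Hill_region_def)
  from crit obtain D where uadm: "u \<in> admissible_loops \<Omega> V h"
    and D: "has_H1_differential (maupertuis m c V h) D u (admissible_loops \<Omega> V h)"
    and D0: "\<And>v. v \<in> H1_loops \<Longrightarrow> D v = 0"
    unfolding maupertuis_critical_def by blast
  have uS: "u s \<in> ?S" if "s \<in> {0..1}" for s
    using uadm that by (simp add: admissible_loops_def)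
  have u01: "u 0 = u 1"
    using uadm by (simp add: admissible_loops_def H1_loops_iff)
  define N where "N = H1_norm v"
  have "0 \<le> N" unfolding N_def by (rule H1_norm_nonneg[OF v(1)])
  have "\<bar>?\<delta>\<bar> \<le> 0 + \<epsilon>" if \<epsilon>: "\<epsilon> > 0" for \<epsilon>
  proof -
    \<comment> \<open>Here and in the choice of \<open>a\<close> below, \<open>N + 1\<close>
      replaces \<open>N\<close> to cover the case that \<open>N\<close> is zero.\<close>
    define e where "e = \<epsilon> / (2 * (N + 1))"
    have "e > 0" using \<epsilon> \<open>0 \<le> N\<close> by (simp add: e_def)
    have "2 * e * N \<le> \<epsilon>"
      using \<epsilon> \<open>0 \<le> N\<close> by (simp add: e_def field_simps)
    obtain d1 where d1: "d1 > 0"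
      "\<And>v q s. \<lbrakk>has_weak_deriv v q; H1_norm v < d1; s \<in> {0..1}\<rbrakk> \<Longrightarrow> u s + v s \<in> ?S"
      "\<And>v q. \<lbrakk>has_weak_deriv v q; H1_norm v < d1\<rbrakk> \<Longrightarrow>
      \<bar>integral {0..1} (\<lambda>s. (norm (p s + q s))\<^sup>2) * integral {0..1} (\<lambda>s. Z m c V h (u s + v s) + 2 * h * m)
       - integral {0..1} (\<lambda>s. (norm (p s))\<^sup>2) * integral {0..1} (\<lambda>s. Z m c V h (u s) + 2 * h * m)
       - (2 * integral {0..1} (\<lambda>s. p s \<bullet> q s) * integral {0..1} (\<lambda>s. Z m c V h (u s) + 2 * h * m)
          + integral {0..1} (\<lambda>s. (norm (p s))\<^sup>2) * integral {0..1} (\<lambda>s. Z_grad m c V h (u s) \<bullet> v s))\<bar>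
      \<le> e * H1_norm v"
      by (rule maupertuis_expansion[OF open_Hill_region[OF \<Omega>]
            GDERIV_Z[OF \<Omega>(2) subsetD[OF S] c] continuous_on_subset[OF continuous_on_Z_grad[OF \<Omega>(2)] S]
            u uS \<open>e > 0\<close>]) (assumption, assumption, rule that)
    obtain d2 where d2: "d2 > 0"
      "\<And>v. \<lbrakk>v \<in> H1_loops; H1_norm v < d2; (\<lambda>s. u s + v s) \<in> admissible_loops \<Omega> V h\<rbrakk> \<Longrightarrow>
        \<bar>maupertuis m c V h (\<lambda>s. u s + v s) - maupertuis m c V h u - D v\<bar> \<le> e * H1_norm v"
      using D \<open>e > 0\<close> unfolding has_H1_differential_def by meson
    define a where "a = min d1 d2 / (2 * (N + 1))"
    have "a > 0" using d1(1) d2(1) \<open>0 \<le> N\<close> by (simp add: a_def)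
    define w where "w = (\<lambda>s. a *\<^sub>R v s)"
    have w: "has_weak_deriv w (\<lambda>s. a *\<^sub>R q s)"
      unfolding w_def by (rule has_weak_deriv_scaleR[OF v(1)])
    have Nw: "H1_norm w = a * N"
      unfolding w_def N_def using H1_norm_scaleR[OF v(1), of a] \<open>a > 0\<close> by simp
    have "a * N \<le> a * (N + 1)"
      using \<open>a > 0\<close> by simp
    also have "\<dots> = min d1 d2 / 2"
      using \<open>0 \<le> N\<close> by (simp add: a_def divide_simps)
    finally have "a * N \<le> min d1 d2 / 2" .
    then have small: "H1_norm w < d1" "H1_norm w < d2"
      using d1(1) d2(1) unfolding Nw by auto
    have wloop: "w \<in> H1_loops"
      using w v(2) by (auto simp: H1_loops_iff w_def)
    have uw: "has_weak_deriv (\<lambda>s. u s + w s) (\<lambda>s. p s + a *\<^sub>R q s)"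
      by (rule has_weak_deriv_add[OF u w])
    then have "(\<lambda>s. u s + w s) \<in> admissible_loops \<Omega> V h"
      using d1(2)[OF w small(1)] u01 v(2) by (auto simp: admissible_loops_def H1_loops_iff w_def)
    then have 1: "\<bar>maupertuis m c V h (\<lambda>s. u s + w s) - maupertuis m c V h u\<bar> \<le> e * (a * N)"
      using d2(2)[OF wloop small(2)] D0[OF wloop] Nw by simp
    have pq: "integral {0..1} (\<lambda>s. p s \<bullet> (a *\<^sub>R q s)) = a * integral {0..1} (\<lambda>s. p s \<bullet> q s)"
      "integral {0..1} (\<lambda>s. Z_grad m c V h (u s) \<bullet> w s) = a * integral {0..1} (\<lambda>s. Z_grad m c V h (u s) \<bullet> v s)"
      by (simp_all add: w_def)
    have 2: "\<bar>maupertuis m c V h (\<lambda>s. u s + w s) - maupertuis m c V h u - a * ?\<delta>\<bar> \<le> e * (a * N)"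
      using d1(3)[OF w small(1)] Nw unfolding pq maupertuis_eq[OF uw] maupertuis_eq[OF u]
      by (simp add: algebra_simps)
    have "\<bar>a * ?\<delta>\<bar> \<le> 2 * (e * (a * N))"
      using 1 2 by linarith
    then have "a * \<bar>?\<delta>\<bar> \<le> a * (2 * e * N)"
      using \<open>a > 0\<close> by (simp add: abs_mult mult_ac)
    then have "\<bar>?\<delta>\<bar> \<le> 2 * e * N"
      using \<open>a > 0\<close> by (simp only: mult_le_cancel_left_pos)
    with \<open>2 * e * N \<le> \<epsilon>\<close> show ?thesis by simp
  qed
  then have "\<bar>?\<delta>\<bar> \<le> 0"
    by (rule field_le_epsilon)
  then show ?thesis by simp
qed

text \<open>Du Bois-Reymond: with \<open>F\<close> a primitive of the forcing term, the first variation is tested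
  with the primitive of \<open>p - F\<close> minus its mean value.\<close>

lemma weak_Euler_Lagrange_imp_C2:
  fixes u :: "real \<Rightarrow> real ^ 'n"
  assumes u: "has_weak_deriv u p" and f: "continuous_on {0..1} f"
    and weak: "\<And>v q. \<lbrakk>has_weak_deriv v q; v 0 = v 1\<rbrakk> \<Longrightarrow>
      integral {0..1} (\<lambda>s. p s \<bullet> q s) + integral {0..1} (\<lambda>s. f s \<bullet> v s) = 0"
  obtains P where "\<And>s. s \<in> {0..1} \<Longrightarrow> (u has_vector_derivative P s) (at s within {0..1})"
    and "\<And>s. s \<in> {0..1} \<Longrightarrow> (P has_vector_derivative f s) (at s within {0..1})"
    and "P 0 = P 1"
proof -
  note L2p = has_weak_deriv_L2[OF u]
  define F where "F = (\<lambda>s. integral {0..s} f)"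
  have F: "(F has_vector_derivative f s) (at s within {0..1})" if "s \<in> {0..1}" for s
    unfolding F_def by (rule integral_has_vector_derivative[OF f that])
  have contF: "continuous_on {0..1} F"
    by (rule continuous_on_vector_derivative[OF F])
  \<comment> \<open>Subtracting this mean makes the primitive \<open>v\<close> of \<open>q\<close>
    return to 0, so that it is a periodic test function.\<close>
  define k where "k = integral {0..1} (\<lambda>s. p s - F s)"
  define q where "q = (\<lambda>s. p s - (F s + k))"
  have contFk: "continuous_on {0..1} (\<lambda>s. F s + k)"
    by (intro continuous_intros contF)
  have L2q: "L2_unit q"
    unfolding q_def by (intro L2_unit_diff L2p L2_unit_continuous contFk)
  have absq: "q absolutely_integrable_on {0..1}"
    by (rule L2_unit_absolutely_integrable[OF L2q])
  then have intq: "q integrable_on {0..1}"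
    by (rule set_lebesgue_integral_eq_integral(1))
  define v where "v = (\<lambda>s. integral {0..s} q)"
  have v: "(q has_integral (v s - v 0)) {0..s}" if "s \<in> {0..1}" for s
  proof -
    have "q integrable_on {0..s}"
      using that by (intro integrable_subinterval_real[OF intq]) auto
    then show ?thesis by (simp add: v_def integrable_integral)
  qed
  then have vq: "has_weak_deriv v q"
    using L2q by (simp add: has_weak_deriv_def)
  have intpF: "(\<lambda>s. p s - F s) integrable_on {0..1}"
    using L2_unit_absolutely_integrable[OF L2p] contF
    by (intro integrable_diff integrable_continuous_real set_lebesgue_integral_eq_integral(1))
  have mean: "integral {0..1} q = 0"
  proof -
    have "((\<lambda>s. (p s - F s) - k) has_integral (k - k)) {0..1}"
      using has_integral_diff[OF integrable_integral[OF intpF] has_integral_const_real[of k 0 1]]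
      by (simp add: k_def)
    then show ?thesis
      by (simp add: q_def algebra_simps integral_unique)
  qed
  have v01: "v 0 = 0" "v 1 = 0"
    using mean by (simp_all add: v_def)
  have parts: "((\<lambda>s. f s \<bullet> v s + F s \<bullet> q s) has_integral 0) {0..1}"
    using integration_by_parts_weak[OF F f absq v] v01 by simp
  have int_pq: "(\<lambda>s. p s \<bullet> q s) integrable_on {0..1}"
    using L2_unit_inner[OF L2p L2q] by (rule set_lebesgue_integral_eq_integral(1))
  have "continuous_on {0..1} v"
    by (rule has_weak_deriv_continuous_on[OF vq])
  then have int_fv: "(\<lambda>s. f s \<bullet> v s) integrable_on {0..1}"
    by (intro integrable_continuous_real continuous_on_inner f)
  have "((\<lambda>s. p s \<bullet> q s + f s \<bullet> v s) has_integral 0) {0..1}"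
    using has_integral_add[OF integrable_integral[OF int_pq] integrable_integral[OF int_fv]]
      weak[OF vq] v01 by simp
  \<comment> \<open>Integration by parts trades the forcing term for
    \<open>- F s \<bullet> q s\<close>, and \<open>k \<bullet> q s\<close> may be subtracted since
    \<open>q\<close> has mean zero. What remains is \<open>p s - F s - k\<close> paired with
    \<open>q s\<close>, that is, \<open>q s\<close> with itself.\<close>
  from has_integral_diff[OF has_integral_diff[OF this parts]
      has_integral_linear[OF integrable_integral[OF intq] bounded_linear_inner_right[of k]]]
  have "((\<lambda>s. (p s \<bullet> q s + f s \<bullet> v s) - (f s \<bullet> v s + F s \<bullet> q s) - k \<bullet> q s) has_integral 0) {0..1}"
    using mean by (simp add: o_def)
  moreover have "(p s \<bullet> q s + f s \<bullet> v s) - (f s \<bullet> v s + F s \<bullet> q s) - k \<bullet> q s = (norm (q s))\<^sup>2" for s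
    unfolding power2_norm_eq_inner by (simp add: q_def inner_diff inner_add)
  ultimately have "integral {0..1} (\<lambda>s. (norm (q s))\<^sup>2) = 0"
    by (simp add: integral_unique)
  then have q0: "integral {0..1} (\<lambda>s. norm (q s)) \<le> 0"
    using L2_unit_integral_norm_le[OF L2q] by simp
  have nq: "(\<lambda>s. norm (q s)) integrable_on {0..1}"
    using absq by (simp add: absolutely_integrable_on_def)
  \<comment> \<open>It suffices that the primitive of \<open>q\<close> vanishes: then
    \<open>u\<close> is a primitive of the continuous function \<open>F + k\<close>, and is
    classically differentiable at every point.\<close>
  have v0: "v s = 0" if s: "s \<in> {0..1}" for s
  proof -
    have sub: "(\<lambda>s. norm (q s)) integrable_on {0..s}"
      using s by (intro integrable_subinterval_real[OF nq]) auto
    have "norm (v s - v 0) \<le> integral {0..s} (\<lambda>s. norm (q s))"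
      by (rule has_integral_norm_le[OF v[OF s] integrable_integral[OF sub]]) simp
    also have "\<dots> \<le> integral {0..1} (\<lambda>s. norm (q s))"
      using s by (intro integral_subset_le sub nq) auto
    finally have "norm (v s) \<le> 0"
      using q0 v01 by (simp del: norm_le_zero_iff)
    then show ?thesis by simp
  qed
  have u_eq: "u s = u 0 + integral {0..s} (\<lambda>s. F s + k)" if s: "s \<in> {0..1}" for s
  proof -
    have "((\<lambda>r. p r - q r) has_integral (u s - u 0) - (v s - v 0)) {0..s}"
      by (intro has_integral_diff has_weak_deriv_integral[OF u s] v[OF s])
    then have "((\<lambda>r. F r + k) has_integral (u s - u 0)) {0..s}"
      using v0[OF s] v01 by (simp add: q_def)
    then show ?thesis by (simp add: integral_unique)
  qed
  show thesis
  proof (rule that)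
    fix s :: real assume s: "s \<in> {0..1}"
    have "((\<lambda>s. u 0 + integral {0..s} (\<lambda>s. F s + k)) has_vector_derivative 0 + (F s + k)) (at s within {0..1})"
      by (intro has_vector_derivative_add has_vector_derivative_const
          integral_has_vector_derivative[OF contFk s])
    then show "(u has_vector_derivative F s + k) (at s within {0..1})"
      by (intro has_vector_derivative_transform[OF s, of u "\<lambda>s. u 0 + integral {0..s} (\<lambda>s. F s + k)"])
        (auto intro: u_eq)
    show "((\<lambda>s. F s + k) has_vector_derivative f s) (at s within {0..1})"
      using has_vector_derivative_add[OF F[OF s] has_vector_derivative_const[of k]] by simp
  next
    \<comment> \<open>Testing with the constant vector \<open>F 1\<close> leaves only the forcing
      term and gives \<open>F 1 \<bullet> F 1 = 0\<close>. This is the periodicity of the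
      derivative.\<close>
    have "has_weak_deriv (\<lambda>_. F 1) (\<lambda>_. 0)"
      by (rule has_weak_deriv_if_C1) (auto intro: derivative_eq_intros)
    then have "integral {0..1} (\<lambda>s. f s \<bullet> F 1) = 0"
      using weak[of "\<lambda>_. F 1" "\<lambda>_. 0"] by simp
    moreover have "integral {0..1} (\<lambda>s. f s \<bullet> F 1) = F 1 \<bullet> F 1"
      using has_integral_linear[OF integrable_integral[OF integrable_continuous_real[OF f]]
          bounded_linear_inner_left[of "F 1"]] by (simp add: o_def F_def integral_unique)
    ultimately show "F 0 + k = F 1 + k"
      by (simp add: F_def)
  qed
qed

section \<open>Changes of time\<close>

text \<open>The map wanted is the inverse of the primitive \<theta> of \<tau>: its derivative is the
  reciprocal of \<tau>, and the inverse of the new map is \<theta> again, so both are of class C1.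
  It is used to pass from loop parameter to time and back.\<close>

lemma inverse_of_positive_integral:
  fixes \<tau> :: "real \<Rightarrow> real"
  assumes b: "b > 0" and \<tau>: "continuous_on {0..b} \<tau>" and pos: "\<And>s. s \<in> {0..b} \<Longrightarrow> \<tau> s > 0"
  defines "L \<equiv> integral {0..b} \<tau>"
  obtains \<upsilon> where "L > 0" and "change_of_variable \<upsilon> 0 L 0 b"
    and "\<upsilon> ` {0..L} = {0..b}" and "\<upsilon> 0 = 0" and "\<upsilon> L = b"
    and "\<And>t. t \<in> {0..L} \<Longrightarrow> (\<upsilon> has_real_derivative 1 / \<tau> (\<upsilon> t)) (at t within {0..L})"
proof -
  define \<theta> where "\<theta> = (\<lambda>s. integral {0..s} \<tau>)"
  have \<theta>_deriv: "(\<theta> has_real_derivative \<tau> s) (at s within {0..b})" if "s \<in> {0..b}" for s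
    unfolding \<theta>_def by (rule integral_has_real_derivative[OF \<tau> that])
  have cont\<theta>: "continuous_on {0..b} \<theta>"
    by (rule DERIV_continuous_on[OF \<theta>_deriv])
  have \<theta>0: "\<theta> 0 = 0" and \<theta>b: "\<theta> b = L"
    by (simp_all add: \<theta>_def L_def)
  obtain s0 where s0: "s0 \<in> {0..b}" "\<And>s. s \<in> {0..b} \<Longrightarrow> \<tau> s0 \<le> \<tau> s"
    using continuous_attains_inf[OF _ _ \<tau>] b by auto
  \<comment> \<open>The minimum of \<tau> is a lower bound for the growth rate of \<theta>; its
    reciprocal is a Lipschitz constant of the inverse, whence continuity.\<close>
  define \<mu> where "\<mu> = \<tau> s0"
  have "\<mu> > 0" using pos[OF s0(1)] by (simp add: \<mu>_def)
  have growth: "\<mu> * (s - r) \<le> \<theta> s - \<theta> r" if "0 \<le> r" "r \<le> s" "s \<le> b" for r s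
  proof -
    have "continuous_on {0..s} \<tau>" "continuous_on {r..s} \<tau>"
      using that by (auto intro: continuous_on_subset[OF \<tau>])
    then have "\<theta> s - \<theta> r = integral {r..s} \<tau>" "\<tau> integrable_on {r..s}"
      using Henstock_Kurzweil_Integration.integral_combine[of 0 r s \<tau>] that
      by (auto simp: \<theta>_def integrable_continuous_real)
    moreover have "integral {r..s} (\<lambda>_. \<mu>) \<le> integral {r..s} \<tau>"
      using that s0(2) \<open>\<tau> integrable_on {r..s}\<close>
      by (intro integral_le) (auto simp: \<mu>_def)
    ultimately show ?thesis
      using that by (simp add: mult.commute)
  qed
  have less: "\<theta> r < \<theta> s" if "0 \<le> r" "r < s" "s \<le> b" for r s
  proof -
    have "0 < \<mu> * (s - r)" using that \<open>\<mu> > 0\<close> by simp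
    then show ?thesis using growth[of r s] that by simp
  qed
  have "L > 0" using less[of 0 b] b \<theta>0 \<theta>b by simp
  have inj: "inj_on \<theta> {0..b}"
  proof (rule inj_onI)
    fix r s assume "r \<in> {0..b}" "s \<in> {0..b}" "\<theta> r = \<theta> s"
    then show "r = s"
      using less[of r s] less[of s r] by (cases r s rule: linorder_cases) auto
  qed
  have image: "\<theta> ` {0..b} = {0..L}"
  proof
    show "\<theta> ` {0..b} \<subseteq> {0..L}"
    proof
      fix t assume "t \<in> \<theta> ` {0..b}"
      then obtain s where "s \<in> {0..b}" "t = \<theta> s" by auto
      then show "t \<in> {0..L}"
        using less[of 0 s] less[of s b] \<theta>0 \<theta>b by (cases "s = 0"; cases "s = b") auto
    qed
    show "{0..L} \<subseteq> \<theta> ` {0..b}"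
    proof
      fix t assume "t \<in> {0..L}"
      then obtain s where "0 \<le> s" "s \<le> b" "\<theta> s = t"
        using IVT'[of \<theta> 0 t b] \<theta>0 \<theta>b cont\<theta> b by auto
      then show "t \<in> \<theta> ` {0..b}" by auto
    qed
  qed
  have bij: "bij_betw \<theta> {0..b} {0..L}"
    using inj image by (simp add: bij_betw_def)
  define \<upsilon> where "\<upsilon> = the_inv_into {0..b} \<theta>"
  have bij\<upsilon>: "bij_betw \<upsilon> {0..L} {0..b}"
    unfolding \<upsilon>_def by (rule bij_betw_the_inv_into[OF bij])
  then have image\<upsilon>: "\<upsilon> ` {0..L} = {0..b}"
    by (simp add: bij_betw_def)
  have \<upsilon>\<theta>: "\<upsilon> (\<theta> s) = s" if "s \<in> {0..b}" for s
    unfolding \<upsilon>_def by (rule the_inv_into_f_f[OF inj that])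
  have \<theta>\<upsilon>: "\<theta> (\<upsilon> t) = t" if "t \<in> {0..L}" for t
    unfolding \<upsilon>_def using that image by (intro f_the_inv_into_f[OF inj]) auto
  have \<upsilon>_in: "\<upsilon> t \<in> {0..b}" if "t \<in> {0..L}" for t
    using that image\<upsilon> by blast
  have mono: "\<upsilon> r < \<upsilon> t" if "r \<in> {0..L}" "t \<in> {0..L}" "r < t" for r t
    using that less[of "\<upsilon> t" "\<upsilon> r"] \<upsilon>_in[of r] \<upsilon>_in[of t] \<theta>\<upsilon>[of r] \<theta>\<upsilon>[of t]
    by (cases "\<upsilon> r" "\<upsilon> t" rule: linorder_cases) auto
  have Lip: "\<bar>\<upsilon> r - \<upsilon> t\<bar> \<le> (1 / \<mu>) * \<bar>r - t\<bar>" if "r \<in> {0..L}" "t \<in> {0..L}" for r t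
    using that growth[of "\<upsilon> r" "\<upsilon> t"] growth[of "\<upsilon> t" "\<upsilon> r"] \<upsilon>_in[of r] \<upsilon>_in[of t]
      \<theta>\<upsilon>[of r] \<theta>\<upsilon>[of t] \<open>\<mu> > 0\<close>
    by (cases "\<upsilon> r \<le> \<upsilon> t") (auto simp: field_simps abs_if)
  have cont\<upsilon>: "continuous_on {0..L} \<upsilon>"
    using Lip \<open>\<mu> > 0\<close>
    by (intro lipschitz_on_continuous_on[of "1 / \<mu>"]) (auto simp: lipschitz_on_def dist_real_def)
  \<comment> \<open>The difference quotient of the inverse is the reciprocal of that of \<theta> at
    the image points. Working with filters within the intervals covers the one-sided derivatives at
    the endpoints too.\<close>
  have deriv: "(\<upsilon> has_real_derivative 1 / \<tau> (\<upsilon> t)) (at t within {0..L})" if t: "t \<in> {0..L}" for t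
  proof -
    have "filterlim \<upsilon> (at (\<upsilon> t) within {0..b}) (at t within {0..L})"
      unfolding filterlim_at
    proof
      show "\<forall>\<^sub>F r in at t within {0..L}. \<upsilon> r \<in> {0..b} \<and> \<upsilon> r \<noteq> \<upsilon> t"
        unfolding eventually_at_filter
        using \<upsilon>_in \<theta>\<upsilon> t by (intro always_eventually) metis
      show "(\<upsilon> \<longlongrightarrow> \<upsilon> t) (at t within {0..L})"
        using cont\<upsilon> t by (simp add: continuous_on)
    qed
    moreover have "((\<lambda>s. (\<theta> s - \<theta> (\<upsilon> t)) / (s - \<upsilon> t)) \<longlongrightarrow> \<tau> (\<upsilon> t)) (at (\<upsilon> t) within {0..b})"
      using \<theta>_deriv[OF \<upsilon>_in[OF t]] by (simp add: has_field_derivative_iff)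
    ultimately have "((\<lambda>r. (\<theta> (\<upsilon> r) - \<theta> (\<upsilon> t)) / (\<upsilon> r - \<upsilon> t)) \<longlongrightarrow> \<tau> (\<upsilon> t)) (at t within {0..L})"
      by (rule filterlim_compose[rotated])
    then have "((\<lambda>r. inverse ((\<theta> (\<upsilon> r) - \<theta> (\<upsilon> t)) / (\<upsilon> r - \<upsilon> t))) \<longlongrightarrow> inverse (\<tau> (\<upsilon> t))) (at t within {0..L})"
      using pos[OF \<upsilon>_in[OF t]] by (intro tendsto_inverse) auto
    moreover have "\<forall>\<^sub>F r in at t within {0..L}.
        inverse ((\<theta> (\<upsilon> r) - \<theta> (\<upsilon> t)) / (\<upsilon> r - \<upsilon> t)) = (\<upsilon> r - \<upsilon> t) / (r - t)"
      unfolding eventually_at_filter using \<theta>\<upsilon> t by (intro always_eventually) auto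
    ultimately have "((\<lambda>r. (\<upsilon> r - \<upsilon> t) / (r - t)) \<longlongrightarrow> inverse (\<tau> (\<upsilon> t))) (at t within {0..L})"
      by (rule Lim_transform_eventually)
    then show ?thesis
      by (simp add: has_field_derivative_iff inverse_eq_divide)
  qed
  have "C1_on_interval \<upsilon> 0 L"
    unfolding C1_on_interval_def
  proof (intro exI conjI ballI)
    show "(\<upsilon> has_real_derivative 1 / \<tau> (\<upsilon> t)) (at t within {0..L})" if "t \<in> {0..L}" for t
      using that by (rule deriv)
    show "continuous_on {0..L} (\<lambda>t. 1 / \<tau> (\<upsilon> t))"
    proof (intro continuous_on_divide continuous_on_const ballI)
      show "continuous_on {0..L} (\<lambda>t. \<tau> (\<upsilon> t))"
        using \<upsilon>_in by (intro continuous_on_compose2[OF \<tau> cont\<upsilon>]) auto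
      show "\<tau> (\<upsilon> t) \<noteq> 0" if "t \<in> {0..L}" for t
        using pos[OF \<upsilon>_in[OF that]] by simp
    qed
  qed
  moreover have "C1_on_interval (the_inv_into {0..L} \<upsilon>) 0 b"
    unfolding C1_on_interval_def
  proof (intro exI conjI ballI)
    fix s assume s: "s \<in> {0..b}"
    have inv: "the_inv_into {0..L} \<upsilon> r = \<theta> r" if "r \<in> {0..b}" for r
      using that bij\<upsilon> image \<upsilon>\<theta> by (intro the_inv_into_f_eq) (auto simp: bij_betw_def)
    show "(the_inv_into {0..L} \<upsilon> has_real_derivative \<tau> s) (at s within {0..b})"
      by (rule has_field_derivative_transform_within[OF \<theta>_deriv[OF s] zero_less_one s]) (simp add: inv)
  qed (rule \<tau>)
  ultimately have "change_of_variable \<upsilon> 0 L 0 b"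
    using bij\<upsilon> mono by (simp add: change_of_variable_def strict_mono_on_def)
  then show thesis
    using \<upsilon>\<theta>[of 0] \<upsilon>\<theta>[of b] b \<theta>0 \<theta>b by (intro that[OF \<open>L > 0\<close> _ image\<upsilon> _ _ deriv]) auto
qed

section \<open>Critical loops and periodic solutions\<close>

lemma has_vector_derivative_norm_square:
  fixes p :: "real \<Rightarrow> 'a::real_inner"
  assumes "(p has_vector_derivative f) (at s within X)"
  shows "((\<lambda>s. (norm (p s))\<^sup>2) has_vector_derivative 2 * (p s \<bullet> f)) (at s within X)"
proof -
  have "((\<lambda>s. p s \<bullet> p s) has_derivative (\<lambda>h. p s \<bullet> (h *\<^sub>R f) + (h *\<^sub>R f) \<bullet> p s)) (at s within X)"
    using assms unfolding has_vector_derivative_def by (intro has_derivative_inner)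
  then show ?thesis
    unfolding has_vector_derivative_def power2_norm_eq_inner
    by (rule has_derivative_eq_rhs) (auto simp: inner_commute)
qed

lemma GDERIV_chain:
  assumes "GDERIV W (u s) :> w" and "(u has_vector_derivative p) (at s within X)"
  shows "((\<lambda>s. W (u s)) has_vector_derivative (p \<bullet> w)) (at s within X)"
proof -
  have "((\<lambda>s. W (u s)) has_derivative (\<lambda>h. (h *\<^sub>R p) \<bullet> w)) (at s within X)"
    using has_derivative_compose[OF assms(2)[unfolded has_vector_derivative_def] assms(1)[unfolded gderiv_def]] .
  then show ?thesis
    unfolding has_vector_derivative_def by (rule has_derivative_eq_rhs) auto
qed

lemma energy_identity:
  fixes u p :: "real \<Rightarrow> real ^ 'n"
  assumes W: "\<And>s. s \<in> {0..1} \<Longrightarrow> GDERIV W (u s) :> g (u s)"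
    and u: "\<And>s. s \<in> {0..1} \<Longrightarrow> (u has_vector_derivative p s) (at s within {0..1})"
    and p: "\<And>s. s \<in> {0..1} \<Longrightarrow> (p has_vector_derivative ((k / 2) *\<^sub>R g (u s))) (at s within {0..1})"
    and mean: "integral {0..1} (\<lambda>s. (norm (p s))\<^sup>2) = k * integral {0..1} (\<lambda>s. W (u s))"
    and s: "s \<in> {0..1}"
  shows "(norm (p s))\<^sup>2 = k * W (u s)"
proof -
  define E where "E = (\<lambda>s. (norm (p s))\<^sup>2 - k * W (u s))"
  have E: "(E has_derivative (\<lambda>h. 0)) (at s within {0..1})" if "s \<in> {0..1}" for s
  proof -
    have "(E has_vector_derivative 2 * (p s \<bullet> ((k / 2) *\<^sub>R g (u s))) - k * (p s \<bullet> g (u s))) (at s within {0..1})"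
      unfolding E_def using that
      by (intro has_vector_derivative_diff has_vector_derivative_norm_square p
          has_vector_derivative_mult_right GDERIV_chain W u)
    then show ?thesis by (simp add: has_vector_derivative_def)
  qed
  have const: "E r = E s" if "r \<in> {0..1}" for r
    by (rule has_derivative_zero_unique[OF _ E that s]) auto
  have "continuous_on {0..1} p"
    by (rule continuous_on_vector_derivative[OF p])
  moreover have "continuous_on {0..1} (\<lambda>s. W (u s))"
    by (rule continuous_on_vector_derivative[OF GDERIV_chain[OF W u]])
  ultimately have "(E has_integral (integral {0..1} (\<lambda>s. (norm (p s))\<^sup>2) - k * integral {0..1} (\<lambda>s. W (u s)))) {0..1}"
    unfolding E_def
    by (intro has_integral_diff has_integral_mult_right integrable_integral
        integrable_continuous_real continuous_intros)
  then have "(E has_integral 0) {0..1}"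
    by (simp add: mean)
  moreover have "(E has_integral E s) {0..1}"
    using has_integral_eq[OF _ has_integral_const_real[of "E s" 0 1], of E] const by simp
  ultimately have "E s = 0"
    using has_integral_unique by blast
  then show ?thesis by (simp add: E_def)
qed

lemma norm_less_speed:
  assumes "c > 0" and "1 - (norm v)\<^sup>2 / c\<^sup>2 = r\<^sup>2" and "r > 0"
  shows "norm v < c"
proof -
  have "(norm v)\<^sup>2 / c\<^sup>2 < 1"
    using assms(2,3) zero_less_power[of r 2] by linarith
  then have "(norm v)\<^sup>2 < c\<^sup>2"
    using assms(1) by (simp add: divide_simps)
  then show ?thesis
    using assms(1) by (intro power_less_imp_less_base[of "norm v" 2 c]) auto
qed

lemma critical_loop_imp_periodic_solution:
  fixes u :: "real \<Rightarrow> real ^ 'n"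
  assumes m: "m > 0" and c: "c > 0" and \<Omega>: "open \<Omega>" "C1_potential_on \<Omega> V"
    and crit: "maupertuis_critical m c \<Omega> V h u" and nonconst: "\<not> u constant_on {0..1}"
  obtains T \<upsilon> where "T > 0" and "change_of_variable \<upsilon> 0 T 0 1"
    and "periodic_solution m c \<Omega> V T (\<lambda>t. u (\<upsilon> t))"
    and "\<not> (\<lambda>t. u (\<upsilon> t)) constant_on {0..T}"
    and "energy_law m c V h T (\<lambda>t. u (\<upsilon> t))"
proof -
  define W where "W = (\<lambda>x. Z m c V h x + 2 * h * m)"
  define g where "g = Z_grad m c V h"
  define G where "G = (\<lambda>x. V x + h + m * c\<^sup>2)"
  have uadm: "u \<in> admissible_loops \<Omega> V h"
    using crit by (simp add: maupertuis_critical_def)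
  then obtain p0 where p0: "has_weak_deriv u p0" and u01: "u 0 = u 1"
    by (auto simp: admissible_loops_def H1_loops_iff)
  have uH: "u s \<in> \<Omega>" "V (u s) + h > 0" if "s \<in> {0..1}" for s
    using uadm that by (auto simp: admissible_loops_def Hill_region_def)
  have contu: "continuous_on {0..1} u"
    by (rule has_weak_deriv_continuous_on[OF p0])
  have contV: "continuous_on {0..1} (\<lambda>s. V (u s))"
    using uH by (intro continuous_on_compose2[OF continuous_on_potential[OF \<Omega>(2)] contu]) auto
  have contg: "continuous_on {0..1} (\<lambda>s. g (u s))"
    using uH unfolding g_def
    by (intro continuous_on_compose2[OF continuous_on_Z_grad[OF \<Omega>(2)] contu]) auto
  have contW: "continuous_on {0..1} (\<lambda>s. W (u s))"
    unfolding W_def Z_def by (intro continuous_intros contV)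
  have Gpos: "G (u s) > 0" if "s \<in> {0..1}" for s
    using uH[OF that] m c by (auto simp: G_def intro: add_pos_pos)
  have WG: "c\<^sup>2 * W x = (G x)\<^sup>2 - (m * c\<^sup>2)\<^sup>2" for x
    unfolding W_def G_def using Z_energy[of c m V h x] c by simp
  have Wpos: "W (u s) > 0" if "s \<in> {0..1}" for s
  proof -
    have "(m * c\<^sup>2)\<^sup>2 < (G (u s))\<^sup>2"
      using uH[OF that] m c by (intro power_strict_mono) (auto simp: G_def)
    then have "0 < c\<^sup>2 * W (u s)" by (simp add: WG)
    then show ?thesis using c by (simp add: zero_less_mult_iff)
  qed
  define A where "A = integral {0..1} (\<lambda>s. (norm (p0 s))\<^sup>2)"
  define B where "B = integral {0..1} (\<lambda>s. W (u s))"
  have intW: "(\<lambda>s. W (u s)) integrable_on {0..1}"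
    by (rule integrable_continuous_real[OF contW])
  have "B \<noteq> 0"
  proof
    assume "B = 0"
    then have "W (u 0) = 0"
      using integral_eq_0_iff[OF contW zero_less_one less_imp_le[OF Wpos]] by (simp add: B_def)
    then show False using Wpos[of 0] by simp
  qed
  moreover have "B \<ge> 0"
    unfolding B_def using Wpos by (intro Henstock_Kurzweil_Integration.integral_nonneg intW less_imp_le)
  ultimately have "B > 0" by simp
  have "A \<ge> 0"
    unfolding A_def using L2_unit_square_integrable[OF has_weak_deriv_L2[OF p0]]
    by (intro Henstock_Kurzweil_Integration.integral_nonneg) auto
  \<comment> \<open>Here non-constancy enters: if \<open>A\<close> were 0, the integral of
    \<open>norm (p0 s)\<close>, which bounds every displacement of \<open>u\<close>, would
    vanish.\<close>
  moreover have "A \<noteq> 0"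
  proof
    assume "A = 0"
    then have zero: "integral {0..1} (\<lambda>s. norm (p0 s)) \<le> 0"
      using L2_unit_integral_norm_le[OF has_weak_deriv_L2[OF p0]] by (simp add: A_def)
    have "u s = u 0" if s: "s \<in> {0..1}" for s
    proof -
      have int: "(\<lambda>s. norm (p0 s)) integrable_on {0..1}"
        using L2_unit_absolutely_integrable[OF has_weak_deriv_L2[OF p0]]
        by (simp add: absolutely_integrable_on_def)
      have sub: "(\<lambda>s. norm (p0 s)) integrable_on {0..s}"
        using s by (intro integrable_subinterval_real[OF int]) auto
      have "norm (u s - u 0) \<le> integral {0..s} (\<lambda>s. norm (p0 s))"
        by (rule has_integral_norm_le[OF has_weak_deriv_integral[OF p0 s] integrable_integral[OF sub]]) simp
      also have "\<dots> \<le> integral {0..1} (\<lambda>s. norm (p0 s))"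
        using s by (intro integral_subset_le sub int) auto
      finally have "norm (u s - u 0) \<le> 0"
        using zero by linarith
      then show ?thesis by simp
    qed
    then show False
      using nonconst unfolding constant_on_def by blast
  qed
  ultimately have "A > 0" by simp
  define k where "k = A / B"
  have "k > 0" using \<open>A > 0\<close> \<open>B > 0\<close> by (simp add: k_def)
  have contf: "continuous_on {0..1} (\<lambda>s. (k / 2) *\<^sub>R g (u s))"
    by (intro continuous_intros contg)
  have weak: "integral {0..1} (\<lambda>s. p0 s \<bullet> q s) + integral {0..1} (\<lambda>s. ((k / 2) *\<^sub>R g (u s)) \<bullet> v s) = 0"
    if "has_weak_deriv v q" "v 0 = v 1" for v q
  proof -
    have "2 * integral {0..1} (\<lambda>s. p0 s \<bullet> q s) * B + A * integral {0..1} (\<lambda>s. g (u s) \<bullet> v s) = 0"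
      using critical_first_variation[OF _ \<Omega> crit p0 that] c
      by (simp add: A_def B_def W_def g_def)
    then show ?thesis
      using \<open>B > 0\<close> by (simp add: k_def field_simps)
  qed
  obtain p where u: "\<And>s. s \<in> {0..1} \<Longrightarrow> (u has_vector_derivative p s) (at s within {0..1})"
    and p: "\<And>s. s \<in> {0..1} \<Longrightarrow> (p has_vector_derivative (k / 2) *\<^sub>R g (u s)) (at s within {0..1})"
    and p01: "p 0 = p 1"
    by (rule weak_Euler_Lagrange_imp_C2[OF p0 contf weak]) (assumption, assumption, rule that)
  have contp: "continuous_on {0..1} p"
    by (rule continuous_on_vector_derivative[OF p])
  \<comment> \<open>\<open>A\<close> was computed with the weak derivative \<open>p0\<close>; the
    energy identity needs it for the classical derivative \<open>p\<close>.\<close>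
  have "A = integral {0..1} (\<lambda>s. (norm (p s))\<^sup>2)"
    unfolding A_def by (rule has_weak_deriv_unique_norm[OF p0 has_weak_deriv_if_C1[OF u contp]])
  then have mean: "integral {0..1} (\<lambda>s. (norm (p s))\<^sup>2) = k * integral {0..1} (\<lambda>s. W (u s))"
    using \<open>B > 0\<close> by (simp add: k_def flip: B_def)
  have normp: "(norm (p s))\<^sup>2 = k * W (u s)" if "s \<in> {0..1}" for s
    using _ u p mean that
  proof (rule energy_identity)
    show "GDERIV W (u s) :> g (u s)" if "s \<in> {0..1}" for s
      unfolding W_def g_def using GDERIV_Z[OF \<Omega>(2) uH(1)[OF that]] c by simp
  qed
  define \<tau> where "\<tau> = (\<lambda>s. sqrt k * G (u s) / c\<^sup>2)"
  have cont\<tau>: "continuous_on {0..1} \<tau>"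
    unfolding \<tau>_def G_def using c by (intro continuous_intros contV) auto
  have \<tau>pos: "\<tau> s > 0" if "s \<in> {0..1}" for s
    using Gpos[OF that] \<open>k > 0\<close> c by (simp add: \<tau>_def)
  define T where "T = integral {0..1} \<tau>"
  obtain \<upsilon> where T: "T > 0" and cov: "change_of_variable \<upsilon> 0 T 0 1"
    and im: "\<upsilon> ` {0..T} = {0..1}" and \<upsilon>0: "\<upsilon> 0 = 0" and \<upsilon>T: "\<upsilon> T = 1"
    and \<upsilon>: "\<And>t. t \<in> {0..T} \<Longrightarrow> (\<upsilon> has_real_derivative 1 / \<tau> (\<upsilon> t)) (at t within {0..T})"
    by (rule inverse_of_positive_integral[OF zero_less_one cont\<tau> \<tau>pos, folded T_def])
      (assumption, rule that)
  have \<upsilon>in: "\<upsilon> t \<in> {0..1}" if "t \<in> {0..T}" for t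
    using im that by blast
  define x where "x = (\<lambda>t. u (\<upsilon> t))"
  have chain: "((\<lambda>t. f (\<upsilon> t)) has_vector_derivative (1 / \<tau> (\<upsilon> t)) *\<^sub>R f') (at t within {0..T})"
    if "t \<in> {0..T}" and "(f has_vector_derivative f') (at (\<upsilon> t) within {0..1})" for f f' t
    using vector_diff_chain_within[of \<upsilon> "1 / \<tau> (\<upsilon> t)" t "{0..T}" f f'] \<upsilon>[OF that(1)] that(2)
    by (simp add: im o_def has_real_derivative_iff_has_vector_derivative)
  have x: "(x has_vector_derivative (1 / \<tau> (\<upsilon> t)) *\<^sub>R p (\<upsilon> t)) (at t within {0..T})"
    if "t \<in> {0..T}" for t
    unfolding x_def by (intro chain that u \<upsilon>in)
  have vel: "velocity T x t = (1 / \<tau> (\<upsilon> t)) *\<^sub>R p (\<upsilon> t)" if "t \<in> {0..T}" for t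
    unfolding velocity_def by (rule vector_derivative_within_closed_interval[OF T that x[OF that]])
  \<comment> \<open>This is already the energy law: dividing \<open>k * W\<close> by the square of
    \<tau> removes \<open>k\<close>, and \<open>WG\<close> turns the result into
    \<open>c\<^sup>2\<close> times \<open>1 - (m * c\<^sup>2 / G)\<^sup>2\<close>. Positivity of
    \<open>G\<close> then selects the sign of the root, and the speed bound follows as well.\<close>
  have gam2: "1 - (norm (velocity T x t))\<^sup>2 / c\<^sup>2 = (m * c\<^sup>2 / G (x t))\<^sup>2" if t: "t \<in> {0..T}" for t
  proof -
    have "(norm (velocity T x t))\<^sup>2 = k * W (x t) / (\<tau> (\<upsilon> t))\<^sup>2"
      using normp[OF \<upsilon>in[OF t]] unfolding vel[OF t]
      by (simp add: power_mult_distrib power_divide x_def)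
    also have "\<dots> = c\<^sup>2 * (c\<^sup>2 * W (x t)) / (G (x t))\<^sup>2"
      using \<open>k > 0\<close> Gpos[OF \<upsilon>in[OF t]] c
      by (simp add: \<tau>_def x_def power_mult_distrib power_divide field_simps)
    also have "\<dots> = c\<^sup>2 * ((G (x t))\<^sup>2 - (m * c\<^sup>2)\<^sup>2) / (G (x t))\<^sup>2"
      by (simp only: WG)
    finally show ?thesis
      using Gpos[OF \<upsilon>in[OF t]] c by (simp add: x_def power_divide diff_divide_distrib)
  qed
  have gam_pos: "m * c\<^sup>2 / G (x t) > 0" if t: "t \<in> {0..T}" for t
    using Gpos[OF \<upsilon>in[OF t]] m c by (simp add: x_def)
  have gam: "sqrt (1 - (norm (velocity T x t))\<^sup>2 / c\<^sup>2) = m * c\<^sup>2 / G (x t)" if t: "t \<in> {0..T}" for t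
    by (rule real_sqrt_unique[OF gam2[OF t, symmetric] less_imp_le[OF gam_pos[OF t]]])
  have mom: "momentum m c T x t = (1 / sqrt k) *\<^sub>R p (\<upsilon> t)" if t: "t \<in> {0..T}" for t
    unfolding momentum_def gam[OF t] unfolding vel[OF t]
    using Gpos[OF \<upsilon>in[OF t]] m c \<open>k > 0\<close> by (simp add: \<tau>_def x_def)
  have "relativistic_solution m c \<Omega> V T x"
    unfolding relativistic_solution_def
  proof (intro ballI conjI)
    fix t assume t: "t \<in> {0..T}"
    show "x t \<in> \<Omega>"
      unfolding x_def by (rule uH(1)[OF \<upsilon>in[OF t]])
    show "x differentiable at t within {0..T}"
      using x[OF t] by (rule differentiableI_vector)
    show "norm (velocity T x t) < c"
      by (rule norm_less_speed[OF c gam2[OF t] gam_pos[OF t]])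
    have "((\<lambda>t. (1 / sqrt k) *\<^sub>R p (\<upsilon> t)) has_vector_derivative
        (1 / sqrt k) *\<^sub>R ((1 / \<tau> (\<upsilon> t)) *\<^sub>R ((k / 2) *\<^sub>R g (u (\<upsilon> t))))) (at t within {0..T})"
      by (rule bounded_linear.has_vector_derivative[OF bounded_linear_scaleR_right
            chain[OF t p[OF \<upsilon>in[OF t]]]])
    moreover have "(1 / sqrt k) *\<^sub>R ((1 / \<tau> (\<upsilon> t)) *\<^sub>R ((k / 2) *\<^sub>R g (u (\<upsilon> t)))) = grad V (x t)"
    proof -
      \<comment> \<open>One root of \<open>k\<close> comes from the momentum and one from the change
        of time; \<open>G\<close> cancels between \<tau> and \<open>Z_grad\<close>.\<close>
      have "(1 / sqrt k) * (1 / \<tau> (\<upsilon> t)) * (k / 2) * (2 / c\<^sup>2 * G (u (\<upsilon> t))) = 1"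
        using Gpos[OF \<upsilon>in[OF t]] c \<open>k > 0\<close> by (simp add: \<tau>_def field_simps)
      then show ?thesis
        unfolding g_def Z_grad_def x_def G_def by (simp only: scaleR_scaleR mult.assoc scaleR_one)
    qed
    ultimately show "(momentum m c T x has_vector_derivative grad V (x t)) (at t within {0..T})"
      by (intro has_vector_derivative_transform[OF t mom]) auto
  qed
  moreover have "x 0 = x T"
    using u01 by (simp add: \<upsilon>0 \<upsilon>T x_def)
  \<comment> \<open>The one-sided velocities agree because both \<open>p\<close> and, through the
    closed loop \<open>u\<close>, the factor \<tau> have equal values at the two ends.\<close>
  moreover have "velocity T x 0 = velocity T x T"
    using T u01 p01 by (simp add: vel \<upsilon>0 \<upsilon>T \<tau>_def)
  ultimately have "periodic_solution m c \<Omega> V T x"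
    by (simp add: periodic_solution_def)
  moreover have "\<not> x constant_on {0..T}"
  proof
    assume "x constant_on {0..T}"
    then have "u constant_on {0..1}"
      unfolding constant_on_def x_def im[symmetric] by auto
    with nonconst show False ..
  qed
  moreover have "energy_law m c V h T x"
    unfolding energy_law_def
  proof
    fix t assume t: "t \<in> {0..T}"
    show "m * c\<^sup>2 / sqrt (1 - (norm (velocity T x t))\<^sup>2 / c\<^sup>2) - V (x t) = h + m * c\<^sup>2"
      unfolding gam[OF t] using Gpos[OF \<upsilon>in[OF t]] m c by (simp add: x_def) (simp add: G_def)
  qed
  ultimately show thesis
    using that T cov unfolding x_def by blast
qed

text \<open>Integrating the energy identity shows that the kinetic integral is \<open>k * B\<close>.
  The first variation thus becomes \<open>2 * B\<close> times the weak form of the equation for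
  \<open>p\<close>, which vanishes after integration by parts. By the expansion, the zero functional
  is then the differential.\<close>

lemma C2_loop_critical:
  fixes u p :: "real \<Rightarrow> real ^ 'n"
  assumes c: "c \<noteq> 0" and \<Omega>: "open \<Omega>" "C1_potential_on \<Omega> V"
    and uH: "\<And>s. s \<in> {0..1} \<Longrightarrow> u s \<in> Hill_region \<Omega> V h"
    and u: "\<And>s. s \<in> {0..1} \<Longrightarrow> (u has_vector_derivative p s) (at s within {0..1})"
    and p: "\<And>s. s \<in> {0..1} \<Longrightarrow>
      (p has_vector_derivative ((k / 2) *\<^sub>R Z_grad m c V h (u s))) (at s within {0..1})"
    and loop: "u 0 = u 1" "p 0 = p 1"
    and energy: "\<And>s. s \<in> {0..1} \<Longrightarrow> (norm (p s))\<^sup>2 = k * (Z m c V h (u s) + 2 * h * m)"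
  shows "maupertuis_critical m c \<Omega> V h u"
proof -
  let ?S = "Hill_region \<Omega> V h"
  have S: "?S \<subseteq> \<Omega>" by (auto simp: Hill_region_def)
  have u\<Omega>: "u s \<in> \<Omega>" if "s \<in> {0..1}" for s
    using uH[OF that] S by auto
  have contp: "continuous_on {0..1} p"
    by (rule continuous_on_vector_derivative[OF p])
  have contu: "continuous_on {0..1} u"
    by (rule continuous_on_vector_derivative[OF u])
  have up: "has_weak_deriv u p"
    by (rule has_weak_deriv_if_C1[OF u contp])
  have contg: "continuous_on {0..1} (\<lambda>s. Z_grad m c V h (u s))"
    using u\<Omega> by (intro continuous_on_compose2[OF continuous_on_Z_grad[OF \<Omega>(2)] contu]) auto
  have uadm: "u \<in> admissible_loops \<Omega> V h"
    using up loop(1) uH by (auto simp: admissible_loops_def H1_loops_iff)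
  define B where "B = integral {0..1} (\<lambda>s. Z m c V h (u s) + 2 * h * m)"
  have A: "integral {0..1} (\<lambda>s. (norm (p s))\<^sup>2) = k * B"
  proof -
    have "integral {0..1} (\<lambda>s. (norm (p s))\<^sup>2)
        = integral {0..1} (\<lambda>s. k * (Z m c V h (u s) + 2 * h * m))"
      by (rule Henstock_Kurzweil_Integration.integral_cong) (rule energy)
    then show ?thesis
      by (simp add: B_def)
  qed
  have stationary: "2 * integral {0..1} (\<lambda>s. p s \<bullet> q s) * B
      + integral {0..1} (\<lambda>s. (norm (p s))\<^sup>2) * integral {0..1} (\<lambda>s. Z_grad m c V h (u s) \<bullet> v s) = 0"
    if v: "has_weak_deriv v q" "v 0 = v 1" for v q
  proof -
    note L2q = has_weak_deriv_L2[OF v(1)]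
    have contf: "continuous_on {0..1} (\<lambda>s. (k / 2) *\<^sub>R Z_grad m c V h (u s))"
      by (intro continuous_intros contg)
    \<comment> \<open>The boundary terms cancel because \<open>p\<close> and \<open>v\<close> both
      take equal values at 0 and 1.\<close>
    have parts: "((\<lambda>s. ((k / 2) *\<^sub>R Z_grad m c V h (u s)) \<bullet> v s + p s \<bullet> q s) has_integral 0) {0..1}"
      using integration_by_parts_weak[OF p contf L2_unit_absolutely_integrable[OF L2q]
          has_weak_deriv_integral[OF v(1)]] v(2) loop(2) by simp
    have 1: "(\<lambda>s. Z_grad m c V h (u s) \<bullet> v s) integrable_on {0..1}"
      by (intro integrable_continuous_real continuous_on_inner contg has_weak_deriv_continuous_on[OF v(1)])
    have 2: "(\<lambda>s. p s \<bullet> q s) integrable_on {0..1}"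
      using L2_unit_inner[OF L2_unit_continuous[OF contp] L2q]
      by (rule set_lebesgue_integral_eq_integral(1))
    have "(k / 2) * integral {0..1} (\<lambda>s. Z_grad m c V h (u s) \<bullet> v s) + integral {0..1} (\<lambda>s. p s \<bullet> q s) = 0"
      using has_integral_unique[OF _ parts]
        has_integral_add[OF has_integral_mult_right[OF integrable_integral[OF 1], of "k / 2"]
          integrable_integral[OF 2]] by simp
    then have "integral {0..1} (\<lambda>s. p s \<bullet> q s) = - (k / 2) * integral {0..1} (\<lambda>s. Z_grad m c V h (u s) \<bullet> v s)"
      by simp
    then show ?thesis
      unfolding A by simp
  qed
  have "has_H1_differential (maupertuis m c V h) (\<lambda>_. 0) u (admissible_loops \<Omega> V h)"
    unfolding has_H1_differential_def
  proof (intro conjI allI impI)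
    show "\<exists>K. \<forall>v\<in>H1_loops. \<bar>0\<bar> \<le> K * H1_norm v"
      by (intro exI[of _ 0]) simp
    fix e :: real assume e: "e > 0"
    obtain d where d: "d > 0"
      "\<And>v q s. \<lbrakk>has_weak_deriv v q; H1_norm v < d; s \<in> {0..1}\<rbrakk> \<Longrightarrow> u s + v s \<in> ?S"
      "\<And>v q. \<lbrakk>has_weak_deriv v q; H1_norm v < d\<rbrakk> \<Longrightarrow>
      \<bar>integral {0..1} (\<lambda>s. (norm (p s + q s))\<^sup>2) * integral {0..1} (\<lambda>s. Z m c V h (u s + v s) + 2 * h * m)
       - integral {0..1} (\<lambda>s. (norm (p s))\<^sup>2) * integral {0..1} (\<lambda>s. Z m c V h (u s) + 2 * h * m)
       - (2 * integral {0..1} (\<lambda>s. p s \<bullet> q s) * integral {0..1} (\<lambda>s. Z m c V h (u s) + 2 * h * m)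
          + integral {0..1} (\<lambda>s. (norm (p s))\<^sup>2) * integral {0..1} (\<lambda>s. Z_grad m c V h (u s) \<bullet> v s))\<bar>
      \<le> e * H1_norm v"
      by (rule maupertuis_expansion[OF open_Hill_region[OF \<Omega>]
            GDERIV_Z[OF \<Omega>(2) subsetD[OF S] c] continuous_on_subset[OF continuous_on_Z_grad[OF \<Omega>(2)] S]
            up uH e]) (assumption, assumption, rule that)
    show "\<exists>d>0. \<forall>v\<in>H1_loops. H1_norm v < d \<and> (\<lambda>s. u s + v s) \<in> admissible_loops \<Omega> V h \<longrightarrow>
        \<bar>maupertuis m c V h (\<lambda>s. u s + v s) - maupertuis m c V h u - 0\<bar> \<le> e * H1_norm v"
    proof (intro exI[of _ d] conjI ballI impI d(1))
      fix v :: "real \<Rightarrow> real ^ 'n"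
      assume "v \<in> H1_loops"
        and small: "H1_norm v < d \<and> (\<lambda>s. u s + v s) \<in> admissible_loops \<Omega> V h"
      then obtain q where v: "has_weak_deriv v q" "v 0 = v 1"
        by (auto simp: H1_loops_iff)
      show "\<bar>maupertuis m c V h (\<lambda>s. u s + v s) - maupertuis m c V h u - 0\<bar> \<le> e * H1_norm v"
        using d(3)[OF v(1)] small stationary[OF v, unfolded B_def]
        unfolding maupertuis_eq[OF has_weak_deriv_add[OF up v(1)]] maupertuis_eq[OF up] by simp
    qed
  qed auto
  then show ?thesis
    unfolding maupertuis_critical_def using uadm by (intro conjI exI[of _ "\<lambda>_. 0"]) auto
qed

lemma periodic_solution_imp_critical_loop:
  fixes x :: "real \<Rightarrow> real ^ 'n"
  assumes m: "m > 0" and c: "c > 0" and \<Omega>: "open \<Omega>" "C1_potential_on \<Omega> V" and T: "T > 0"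
    and xH: "\<And>t. t \<in> {0..T} \<Longrightarrow> x t \<in> Hill_region \<Omega> V h"
    and sol: "periodic_solution m c \<Omega> V T x" and nonconst: "\<not> x constant_on {0..T}"
    and energy: "energy_law m c V h T x"
  obtains \<phi> where "change_of_variable \<phi> 0 1 0 T"
    and "maupertuis_critical m c \<Omega> V h (\<lambda>s. x (\<phi> s))"
    and "\<not> (\<lambda>s. x (\<phi> s)) constant_on {0..1}"
proof -
  define G where "G = (\<lambda>x. V x + h + m * c\<^sup>2)"
  define P where "P = momentum m c T x"
  have Gpos: "G (x t) > 0" if "t \<in> {0..T}" for t
    using xH[OF that] m c by (auto simp: G_def Hill_region_def intro: add_pos_pos)
  have x\<Omega>: "x t \<in> \<Omega>" if "t \<in> {0..T}" for t
    using xH[OF that] by (simp add: Hill_region_def)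
  have slow: "norm (velocity T x t) < c"
    and P: "(P has_vector_derivative grad V (x t)) (at t within {0..T})"
    and xdiff: "x differentiable (at t within {0..T})" if "t \<in> {0..T}" for t
    using sol that by (auto simp: periodic_solution_def relativistic_solution_def P_def)
  have x: "(x has_vector_derivative velocity T x t) (at t within {0..T})" if "t \<in> {0..T}" for t
    unfolding velocity_def using xdiff[OF that] by (simp add: vector_derivative_works)
  have contx: "continuous_on {0..T} x"
    by (rule continuous_on_vector_derivative[OF x])
  have contG: "continuous_on {0..T} (\<lambda>t. G (x t))"
    unfolding G_def using x\<Omega>
    by (intro continuous_intros continuous_on_compose2[OF continuous_on_potential[OF \<Omega>(2)] contx]) auto
  have gam: "sqrt (1 - (norm (velocity T x t))\<^sup>2 / c\<^sup>2) = m * c\<^sup>2 / G (x t)" if t: "t \<in> {0..T}" for t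
  proof -
    have "(norm (velocity T x t))\<^sup>2 < c\<^sup>2"
      using slow[OF t] by (intro power_strict_mono) auto
    then have "1 - (norm (velocity T x t))\<^sup>2 / c\<^sup>2 > 0"
      using c by (simp add: divide_simps)
    moreover have "m * c\<^sup>2 / sqrt (1 - (norm (velocity T x t))\<^sup>2 / c\<^sup>2) = G (x t)"
      using energy t by (auto simp: energy_law_def G_def algebra_simps)
    ultimately have "m * c\<^sup>2 = G (x t) * sqrt (1 - (norm (velocity T x t))\<^sup>2 / c\<^sup>2)"
      by (metis less_irrefl nonzero_divide_eq_eq real_sqrt_gt_zero)
    then show ?thesis
      using Gpos[OF t] by simp
  qed
  \<comment> \<open>The equation supplies a derivative for the momentum and not for the velocity.
    This formula lets the loop's derivative be expressed by the momentum, and so be differentiated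
    again.\<close>
  have vel: "velocity T x t = (c\<^sup>2 / G (x t)) *\<^sub>R P t" if t: "t \<in> {0..T}" for t
    unfolding P_def momentum_def gam[OF t] using Gpos[OF t] m c by simp
  have norm_vel: "(G (x t))\<^sup>2 * (norm (velocity T x t))\<^sup>2 = c ^ 4 * (Z m c V h (x t) + 2 * h * m)"
    if t: "t \<in> {0..T}" for t
  proof -
    have "1 - (norm (velocity T x t))\<^sup>2 / c\<^sup>2 \<ge> 0"
      using gam[OF t] Gpos[OF t] m c by (metis divide_pos_pos less_imp_le mult_pos_pos real_sqrt_ge_0_iff zero_less_power)
    then have "1 - (norm (velocity T x t))\<^sup>2 / c\<^sup>2 = (m * c\<^sup>2 / G (x t))\<^sup>2"
      using gam[OF t] by (metis real_sqrt_pow2)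
    then have "(G (x t))\<^sup>2 * (norm (velocity T x t))\<^sup>2 = c\<^sup>2 * ((G (x t))\<^sup>2 - (m * c\<^sup>2)\<^sup>2)"
      using Gpos[OF t] c by (simp add: field_simps)
    also have "\<dots> = c\<^sup>2 * (c\<^sup>2 * (Z m c V h (x t) + 2 * h * m))"
      using Z_energy[of c m V h "x t"] c by (simp add: G_def)
    finally show ?thesis by simp
  qed
  have contG': "continuous_on {0..T} (\<lambda>t. 1 / G (x t))"
    by (intro continuous_on_divide continuous_on_const contG ballI less_imp_neq[OF Gpos, symmetric])
  have G'pos: "1 / G (x t) > 0" if "t \<in> {0..T}" for t
    using Gpos[OF that] by simp
  define I where "I = integral {0..T} (\<lambda>t. 1 / G (x t))"
  \<comment> \<open>The first application of the inversion lemma only yields positivity of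
    \<open>I\<close>. The second one uses the weight divided by \<open>I\<close>, so that the new
    parameter runs through the unit interval.\<close>
  have "I > 0"
    by (rule inverse_of_positive_integral[OF T contG' G'pos, folded I_def])
  define \<tau> where "\<tau> = (\<lambda>t. (1 / I) * (1 / G (x t)))"
  have cont\<tau>: "continuous_on {0..T} \<tau>"
    unfolding \<tau>_def by (rule continuous_on_mult_left[OF contG'])
  have \<tau>pos: "\<tau> t > 0" if "t \<in> {0..T}" for t
    using Gpos[OF that] \<open>I > 0\<close> by (simp add: \<tau>_def)
  have L: "integral {0..T} \<tau> = 1"
    using \<open>I > 0\<close> unfolding \<tau>_def by (subst integral_mult_right) (simp add: I_def)
  obtain \<phi> where cov: "change_of_variable \<phi> 0 1 0 T" and im: "\<phi> ` {0..1} = {0..T}"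
    and \<phi>0: "\<phi> 0 = 0" and \<phi>1: "\<phi> 1 = T"
    and \<phi>: "\<And>s. s \<in> {0..1} \<Longrightarrow> (\<phi> has_real_derivative 1 / \<tau> (\<phi> s)) (at s within {0..1})"
    by (rule inverse_of_positive_integral[OF T cont\<tau> \<tau>pos, unfolded L]) (assumption, rule that)
  have \<phi>in: "\<phi> s \<in> {0..T}" if "s \<in> {0..1}" for s
    using im that by blast
  have chain: "((\<lambda>s. f (\<phi> s)) has_vector_derivative (I * G (x (\<phi> s))) *\<^sub>R f') (at s within {0..1})"
    if "s \<in> {0..1}" and "(f has_vector_derivative f') (at (\<phi> s) within {0..T})" for f f' s
    using vector_diff_chain_within[of \<phi> "1 / \<tau> (\<phi> s)" s "{0..1}" f f'] \<phi>[OF that(1)] that(2)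
    by (simp add: im o_def has_real_derivative_iff_has_vector_derivative \<tau>_def)
  define u where "u = (\<lambda>s. x (\<phi> s))"
  \<comment> \<open>Since \<phi> has derivative \<open>I * G\<close>, the chain rule gives
    \<open>I * G\<close> times the velocity, which by \<open>vel\<close> is this multiple of the
    momentum. Differentiating once more gives \<open>I\<^sup>2 * c\<^sup>2 * G\<close> times the
    gradient of \<open>V\<close>; comparison with \<open>(k / 2) *\<^sub>R Z_grad\<close> determines
    \<open>k\<close>.\<close>
  define p where "p = (\<lambda>s. (I * c\<^sup>2) *\<^sub>R P (\<phi> s))"
  define k where "k = I\<^sup>2 * c ^ 4"
  have "maupertuis_critical m c \<Omega> V h u"
  proof (rule C2_loop_critical[where p = p and k = k, OF _ \<Omega>])
    show "c \<noteq> 0" using c by simp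
    fix s :: real assume s: "s \<in> {0..1}"
    note Gs = Gpos[OF \<phi>in[OF s]]
    show "u s \<in> Hill_region \<Omega> V h"
      unfolding u_def by (rule xH[OF \<phi>in[OF s]])
    have p_eq: "p s = (I * G (x (\<phi> s))) *\<^sub>R velocity T x (\<phi> s)"
      using Gs by (simp add: p_def vel[OF \<phi>in[OF s]])
    then show "(u has_vector_derivative p s) (at s within {0..1})"
      unfolding u_def using chain[OF s x[OF \<phi>in[OF s]]] by simp
    have "(p has_vector_derivative (I * c\<^sup>2) *\<^sub>R ((I * G (x (\<phi> s))) *\<^sub>R grad V (x (\<phi> s)))) (at s within {0..1})"
      unfolding p_def
      by (rule bounded_linear.has_vector_derivative[OF bounded_linear_scaleR_right
            chain[OF s P[OF \<phi>in[OF s]]]])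
    moreover have "I * c\<^sup>2 * (I * G (x (\<phi> s))) = (k / 2) * (2 / c\<^sup>2 * G (x (\<phi> s)))"
      using c by (simp add: k_def power2_eq_square power4_eq_xxxx)
    ultimately show "(p has_vector_derivative (k / 2) *\<^sub>R Z_grad m c V h (u s)) (at s within {0..1})"
      by (simp add: Z_grad_def u_def G_def)
    have "(norm (p s))\<^sup>2 = I\<^sup>2 * ((G (x (\<phi> s)))\<^sup>2 * (norm (velocity T x (\<phi> s)))\<^sup>2)"
      unfolding p_eq by (simp add: power_mult_distrib)
    then show "(norm (p s))\<^sup>2 = k * (Z m c V h (u s) + 2 * h * m)"
      unfolding norm_vel[OF \<phi>in[OF s]] by (simp add: k_def u_def)
  next
    show "u 0 = u 1"
      using sol by (simp add: u_def \<phi>0 \<phi>1 periodic_solution_def)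
    show "p 0 = p 1"
      using sol by (simp add: p_def P_def momentum_def \<phi>0 \<phi>1 periodic_solution_def)
  qed
  moreover have "\<not> u constant_on {0..1}"
  proof
    assume "u constant_on {0..1}"
    then have "x constant_on {0..T}"
      unfolding constant_on_def u_def im[symmetric] by auto
    with nonconst show False ..
  qed
  ultimately show thesis
    using that cov unfolding u_def by blast
qed

theorem proposition2p2:
  fixes m c h :: real
    and \<Omega> :: "(real ^ 'n) set"
    and V :: "real ^ 'n \<Rightarrow> real"
  assumes "m > 0" and "c > 0"
    and "open \<Omega>"
    and "C1_potential_on \<Omega> V"
    and "Hill_region \<Omega> V h \<noteq> {}"
  shows
    "(\<forall>u. maupertuis_critical m c \<Omega> V h u \<and> \<not> u constant_on {0..1} \<longrightarrow>
        (\<exists>T>0. \<exists>\<upsilon>. change_of_variable \<upsilon> 0 T 0 1 \<and>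
          periodic_solution m c \<Omega> V T (\<lambda>t. u (\<upsilon> t)) \<and>
          \<not> (\<lambda>t. u (\<upsilon> t)) constant_on {0..T} \<and>
          energy_law m c V h T (\<lambda>t. u (\<upsilon> t)))) \<and>
     (\<forall>T>0. \<forall>x. (\<forall>t\<in>{0..T}. x t \<in> Hill_region \<Omega> V h) \<and>
          periodic_solution m c \<Omega> V T x \<and>
          \<not> x constant_on {0..T} \<and>
          energy_law m c V h T x \<longrightarrow>
        (\<exists>\<phi>. change_of_variable \<phi> 0 1 0 T \<and>
          maupertuis_critical m c \<Omega> V h (\<lambda>s. x (\<phi> s)) \<and>
          \<not> (\<lambda>s. x (\<phi> s)) constant_on {0..1}))"
proof (intro conjI allI impI)
  fix u assume "maupertuis_critical m c \<Omega> V h u \<and> \<not> u constant_on {0..1}"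
  then show "\<exists>T>0. \<exists>\<upsilon>. change_of_variable \<upsilon> 0 T 0 1 \<and>
      periodic_solution m c \<Omega> V T (\<lambda>t. u (\<upsilon> t)) \<and>
      \<not> (\<lambda>t. u (\<upsilon> t)) constant_on {0..T} \<and>
      energy_law m c V h T (\<lambda>t. u (\<upsilon> t))"
    using critical_loop_imp_periodic_solution[OF assms(1-4)] by metis
next
  fix T :: real and x
  assume "T > 0" and "(\<forall>t\<in>{0..T}. x t \<in> Hill_region \<Omega> V h) \<and>
      periodic_solution m c \<Omega> V T x \<and> \<not> x constant_on {0..T} \<and> energy_law m c V h T x"
  then show "\<exists>\<phi>. change_of_variable \<phi> 0 1 0 T \<and>
      maupertuis_critical m c \<Omega> V h (\<lambda>s. x (\<phi> s)) \<and>
      \<not> (\<lambda>s. x (\<phi> s)) constant_on {0..1}"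
    using periodic_solution_imp_critical_loop[OF assms(1-4)] by metis
qed

end
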